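(* Let $k\ge2$. The data are $(R_0,\Sigma_0)$, with $R_0$ a random $k\times2$ matrix, $vec(R_0)\sim N(a_\Delta\otimes\mu,\Sigma_0)$, $a_\Delta=(\Delta,1)'$, $\Delta\in\mathbb{R}$, $\mu\in\mathbb{R}^k$, and $\Sigma_0$ a known (but not fixed) positive definite $2k\times2k$ matrix; the null is $H_0:\Delta=0$. Define $$IL=\int_{-\infty}^{\infty}\exp\Big\{\tfrac12\big[vec(R_0)'\Sigma_0^{-1/2}N_{\Sigma_0^{-1/2}(a_\Delta\otimes I_k)}\Sigma_0^{-1/2}vec(R_0)-T'T\big]\Big\}\,\big|(a_\Delta'\otimes I_k)\Sigma_0^{-1}(a_\Delta\otimes I_k)\big|^{-1/2}|\Delta|^{k-2}\,d\Delta,$$ and let the conditional integrated likelihood (CIL) test reject $H_0$ when $IL>\kappa_{IL}(T,\Sigma_0)$, where $\kappa_{IL}(t,\Sigma_0)$ is the $1-\alpha$ quantile of $IL$ evaluated at $(S,t,\Sigma_0)$ with $S\sim N(0,I_k)$. Then the CIL test is invariant under the action of $g=(g_1,g_2)\in\mathcal{G}_L(k)\times\mathcal{G}_T(2)$ given by $g\circ(R_0,\Sigma_0)=(g_1R_0g_2',(g_2\otimes g_1)\Sigma_0(g_2'\otimes g_1'))$, and it is the limit of a sequence of weighted-average-power similar tests, i.e. tests that, for weight measures $w$ on $(\Delta,\mu)$, reject when $f_w(r_0,\Sigma_0)/f_S(s)>\kappa_w(t,\Sigma_0)$, where $f_w(r_0,\Sigma_0)=\int f_R(r_0;\Delta,\mu,\Sigma_0)\,dw(\Delta,\mu)$,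 $f_S(s)=(2\pi)^{-k/2}e^{-s's/2}$, and $\kappa_w(t,\Sigma_0)$ makes the null rejection probability conditional on $T=t$ equal to $\alpha$.
   Context: $f_R(r_0;\Delta,\mu,\Sigma_0)$ is the $N(a_\Delta\otimes\mu,\Sigma_0)$ density of $vec(R_0)$. With $e_1=(1,0)'$, $e_2=(0,1)'$: $S=[(e_1'\otimes I_k)\Sigma_0(e_1\otimes I_k)]^{-1/2}(e_1'\otimes I_k)vec(R_0)$ and $T=[(e_2'\otimes I_k)\Sigma_0^{-1}(e_2\otimes I_k)]^{-1/2}(e_2'\otimes I_k)\Sigma_0^{-1}vec(R_0)$, with symmetric square roots; $N_A=A(A'A)^{-1}A'$; $|\cdot|$ of a matrix denotes its determinant. $\mathcal{G}_L(k)$: invertible $k\times k$ matrices; $\mathcal{G}_T(2)$: invertible lower-triangular $2\times2$ matrices. A test $\phi$ is invariant if $\phi(g\circ(R_0,\Sigma_0))=\phi(R_0,\Sigma_0)$ for all $g$. *)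

theory Defs
  imports "HOL-Analysis.Analysis" "HOL-Probability.Probability"
begin

text \<open>A k x 2 matrix R0 is an element of real^2^'k (rows indexed by 'k, columns by 2).
  vec(R0) stacks the columns; it is indexed by pairs (j,i) :: 2 x 'k, j = column, i = row.
  Accordingly 2k x 2k matrices are real^(2 x 'k)^(2 x 'k), and the Kronecker product
  A (x) B is indexed by pairs with the index of A as first component.\<close>

definition vecm :: "real^2^'k \<Rightarrow> real^(2 \<times> 'k)" where
  "vecm R = (\<chi> p. R $ snd p $ fst p)"

definition kron :: "real^'b^'a \<Rightarrow> real^'d^'c \<Rightarrow> real^('b \<times> 'd)^('a \<times> 'c)" where
  "kron A B = (\<chi> p. \<chi> q. A $ fst p $ fst q * B $ snd p $ snd q)"

definition kronc :: "real^'m \<Rightarrow> real^'c^'r \<Rightarrow> real^'c^('m \<times> 'r)" where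
  "kronc a B = (\<chi> p. \<chi> c. a $ fst p * B $ snd p $ c)"

definition kronv :: "real^'m \<Rightarrow> real^'k \<Rightarrow> real^('m \<times> 'k)" where
  "kronv a b = (\<chi> p. a $ fst p * b $ snd p)"

definition aD :: "real \<Rightarrow> real^2" where
  "aD \<Delta> = vector [\<Delta>, 1]"

definition e1 :: "real^2" where "e1 = vector [1, 0]"
definition e2 :: "real^2" where "e2 = vector [0, 1]"

definition pd :: "real^'n^'n \<Rightarrow> bool" where
  "pd A \<longleftrightarrow> transpose A = A \<and> (\<forall>x. x \<noteq> 0 \<longrightarrow> x \<bullet> (A *v x) > 0)"

definition msqrt :: "real^'n^'n \<Rightarrow> real^'n^'n" where
  "msqrt A = (THE B. pd B \<and> B ** B = A)"

definition misqrt :: "real^'n^'n \<Rightarrow> real^'n^'n" where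
  "misqrt A = matrix_inv (msqrt A)"

definition proj :: "real^'c^'r \<Rightarrow> real^'r^'r" where
  "proj A = A ** matrix_inv (transpose A ** A) ** transpose A"

definition Sst :: "real^2^'k \<Rightarrow> real^(2\<times>'k)^(2\<times>'k) \<Rightarrow> real^'k" where
  "Sst R \<Sigma> = (let E = kronc e1 (mat 1 :: real^'k^'k)
                in misqrt (transpose E ** \<Sigma> ** E) *v (transpose E *v vecm R))"

definition Tst :: "real^2^'k \<Rightarrow> real^(2\<times>'k)^(2\<times>'k) \<Rightarrow> real^'k" where
  "Tst R \<Sigma> = (let E = kronc e2 (mat 1 :: real^'k^'k); Si = matrix_inv \<Sigma>
                in misqrt (transpose E ** Si ** E) *v (transpose E *v (Si *v vecm R)))"

definition r_of :: "real^'k \<Rightarrow> real^'k \<Rightarrow> real^(2\<times>'k)^(2\<times>'k) \<Rightarrow> real^2^'k" where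
  "r_of s t \<Sigma> = (THE R. Sst R \<Sigma> = s \<and> Tst R \<Sigma> = t)"

definition IL :: "real^2^'k \<Rightarrow> real^(2\<times>'k)^(2\<times>'k) \<Rightarrow> real" where
  "IL R \<Sigma> = integral\<^sup>L lborel (\<lambda>\<Delta>::real.
      let A = kronc (aD \<Delta>) (mat 1 :: real^'k^'k); r = vecm R; Sh = misqrt \<Sigma>
      in exp ((1/2) * (r \<bullet> ((Sh ** proj (Sh ** A) ** Sh) *v r) - Tst R \<Sigma> \<bullet> Tst R \<Sigma>))
         * det (transpose A ** matrix_inv \<Sigma> ** A) powr (-1/2)
         * \<bar>\<Delta>\<bar> ^ (CARD('k) - 2))"

definition IL_st :: "real^'k \<Rightarrow> real^'k \<Rightarrow> real^(2\<times>'k)^(2\<times>'k) \<Rightarrow> real" where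
  "IL_st s t \<Sigma> = IL (r_of s t \<Sigma>) \<Sigma>"

definition fS :: "real^'k \<Rightarrow> real" where
  "fS s = (2 * pi) powr (- real CARD('k) / 2) * exp (- (s \<bullet> s) / 2)"

definition stdnormal :: "(real^'k) measure" where
  "stdnormal = density lborel (\<lambda>s. ennreal (fS s))"

definition quantile :: "'a measure \<Rightarrow> ('a \<Rightarrow> real) \<Rightarrow> real \<Rightarrow> real" where
  "quantile M X p = Inf {c. measure M {x \<in> space M. X x \<le> c} \<ge> p}"

definition kappa_IL :: "real \<Rightarrow> real^'k \<Rightarrow> real^(2\<times>'k)^(2\<times>'k) \<Rightarrow> real" where
  "kappa_IL \<alpha> t \<Sigma> = quantile stdnormal (\<lambda>s. IL_st s t \<Sigma>) (1 - \<alpha>)"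

text \<open>CIL test (True = reject H0).\<close>
definition cil :: "real \<Rightarrow> real^2^'k \<Rightarrow> real^(2\<times>'k)^(2\<times>'k) \<Rightarrow> bool" where
  "cil \<alpha> R \<Sigma> \<longleftrightarrow> IL R \<Sigma> > kappa_IL \<alpha> (Tst R \<Sigma>) \<Sigma>"

definition act :: "real^'k^'k \<Rightarrow> real^2^2 \<Rightarrow> real^2^'k \<Rightarrow> real^(2\<times>'k)^(2\<times>'k)
                   \<Rightarrow> (real^2^'k) \<times> (real^(2\<times>'k)^(2\<times>'k))" where
  "act g1 g2 R \<Sigma> = (g1 ** R ** transpose g2,
                     kron g2 g1 ** \<Sigma> ** kron (transpose g2) (transpose g1))"

definition fR :: "real^2^'k \<Rightarrow> real \<Rightarrow> real^'k \<Rightarrow> real^(2\<times>'k)^(2\<times>'k) \<Rightarrow> real" where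
  "fR R \<Delta> \<mu> \<Sigma> = (let d = vecm R - kronv (aD \<Delta>) \<mu>
     in (2 * pi) powr (- real CARD('k)) * det \<Sigma> powr (-1/2)
        * exp (- (1/2) * (d \<bullet> (matrix_inv \<Sigma> *v d))))"

definition fw :: "(real \<times> (real^'k)) measure \<Rightarrow> real^2^'k \<Rightarrow> real^(2\<times>'k)^(2\<times>'k) \<Rightarrow> real" where
  "fw w R \<Sigma> = integral\<^sup>L w (\<lambda>p. fR R (fst p) (snd p) \<Sigma>)"

text \<open>WAP test with weight w and critical value function kappa (True = reject).\<close>
definition wap_test :: "(real \<times> (real^'k)) measure \<Rightarrow> (real^'k \<Rightarrow> real^(2\<times>'k)^(2\<times>'k) \<Rightarrow> real)
                        \<Rightarrow> real^2^'k \<Rightarrow> real^(2\<times>'k)^(2\<times>'k) \<Rightarrow> bool" where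
  "wap_test w \<kappa> R \<Sigma> \<longleftrightarrow> fw w R \<Sigma> / fS (Sst R \<Sigma>) > \<kappa> (Tst R \<Sigma>) \<Sigma>"

text \<open>kappa makes the null rejection probability conditional on T = t equal to alpha.
  Under H0, S ~ N(0,I_k) independently of T, so conditionally on T = t the data are
  r_of S t Sigma0 with S ~ N(0,I_k).\<close>
definition similar_cv :: "(real \<times> (real^'k)) measure \<Rightarrow> (real^'k \<Rightarrow> real^(2\<times>'k)^(2\<times>'k) \<Rightarrow> real)
                         \<Rightarrow> real \<Rightarrow> bool" where
  "similar_cv w \<kappa> \<alpha> \<longleftrightarrow> (\<forall>t \<Sigma>. pd \<Sigma> \<longrightarrow>
      measure stdnormal {s. fw w (r_of s t \<Sigma>) \<Sigma> / fS s > \<kappa> t \<Sigma>} = \<alpha>)"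

end

theory Submission
  imports Defs
begin

text \<open>
  Integrating the Gaussian likelihood over \<open>\<mu>\<close> against Lebesgue measure gives the projection term and the
  determinant of \<open>IL\<close>. As \<open>vec(R)' \<Sigma>\<inverse> vec(R) = S'S + T'T\<close>, the ratio \<open>f\<^sub>w / f\<^sub>S\<close> for the infinite weight
  \<open>|\<Delta>| ^ (k - 2) d\<mu> d\<Delta>\<close> is a constant multiple of \<open>IL\<close>; restricting this weight to bounded boxes gives
  finite weights whose statistics increase to that multiple. For fixed \<open>t\<close> each statistic is an integral of
  exponentials of affine functions of \<open>s\<close>, hence strictly convex, so its level sets are null. This makes
  the quantiles exactly similar critical values, and they converge because the statistics increase.

  For invariance, \<open>g\<^sub>2\<close> acts on the direction \<open>(\<Delta>, 1)\<close> as a Moebius map fixing \<open>0\<close>, and the exponent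
  \<open>k - 2\<close> is the one for which the Jacobians of this map and of \<open>\<mu> \<mapsto> g\<^sub>1 \<mu>\<close> combine to a constant. Thus \<open>IL\<close> is
  multiplied by a positive constant, while \<open>S\<close> and \<open>T\<close> are rotated; the conditional quantile is multiplied by
  the same constant.
\<close>

section \<open>Positive definite matrices and symmetric square roots\<close>

text \<open>Convergence of the tests can fail only where the limit statistic equals its critical
  value, and that set must be null in R although both sides vary with T. At fixed t it is a level
  set in s; carrying this over to R takes Fubini, hence measurability of the quantile in t, and the
  linearity of R in (t, s). Growing boxes are used because they bound each approximating statistic
  and its quantile by their limits, which settles both outcomes of the comparison.

  The limiting weight has infinite mass, and a divergent Bochner integral would read as 0, so
  finiteness must be proved: integrating out \<mu> leaves at most a multiple of (1 +
  \<Delta>^2)^(-k/2), which still decays like \<Delta>^(-2) after multiplication by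
  |\<Delta>|^(k-2).

  Symmetric roots are definite descriptions, so they rest on a spectral theorem. They do not
  transform linearly under the group; this is the source of the rotations of S and T, harmless
  because N(0, I) is rotation invariant and T'T is unchanged.\<close>

declare transpose_matrix_vector [simp del] vector_transpose_matrix [simp del]

lemma inner_matrix_vector:
  fixes A :: "real^'n^'m"
  shows "x \<bullet> (A *v y) = (transpose A *v x) \<bullet> y"
  by (simp add: dot_lmul_matrix transpose_matrix_vector)

lemma matrix_inv_mult:
  fixes A :: "real^'n^'n"
  assumes "invertible A"
  shows "A ** matrix_inv A = mat 1" "matrix_inv A ** A = mat 1"
  using someI_ex[OF assms[unfolded invertible_def]] by (simp_all add: matrix_inv_def)

lemma matrix_inv_unique:
  fixes A B :: "real^'n^'n"
  assumes "A ** B = mat 1"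
  shows "matrix_inv A = B"
proof -
  have "invertible A" using assms invertible_right_inverse by blast
  then show ?thesis
    by (metis assms matrix_inv_mult(2) matrix_mul_assoc matrix_mul_lid matrix_mul_rid)
qed

lemma matrix_inv_mult_vec:
  fixes A :: "real^'n^'n"
  assumes "invertible A"
  shows "A *v (matrix_inv A *v x) = x" "matrix_inv A *v (A *v x) = x"
  by (simp_all add: matrix_vector_mul_assoc matrix_inv_mult[OF assms])

lemma invertible_iff_ker:
  fixes A :: "real^'n^'n"
  shows "invertible A \<longleftrightarrow> (\<forall>x. A *v x = 0 \<longrightarrow> x = 0)"
  by (simp add: invertible_left_inverse matrix_left_invertible_ker)

lemma matrix_inv_product:
  fixes A B :: "real^'n^'n"
  assumes "invertible A" "invertible B"
  shows "matrix_inv (A ** B) = matrix_inv B ** matrix_inv A"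
proof (rule matrix_inv_unique)
  have "A ** B ** (matrix_inv B ** matrix_inv A) = A ** (B ** matrix_inv B) ** matrix_inv A"
    by (simp add: matrix_mul_assoc)
  then show "A ** B ** (matrix_inv B ** matrix_inv A) = mat 1"
    by (simp add: matrix_inv_mult assms)
qed

lemma matrix_inv_transpose:
  fixes A :: "real^'n^'n"
  assumes "invertible A"
  shows "matrix_inv (transpose A) = transpose (matrix_inv A)"
  by (rule matrix_inv_unique) (metis assms matrix_inv_mult(2) matrix_transpose_mul transpose_mat)

lemma invertible_matrix_inv:
  fixes A :: "real^'n^'n"
  assumes "invertible A"
  shows "invertible (matrix_inv A)"
  using assms invertible_left_inverse matrix_inv_mult(1) by blast

text \<open>A maximiser v of the quadratic form x . f x on the unit sphere of V is an eigenvector.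
  The residual w = f v - c v lies in V and is orthogonal to v; moving from v towards w would
  increase the form to first order unless w = 0.\<close>

lemma selfadjoint_eigenvector:
  fixes f :: "'a::euclidean_space \<Rightarrow> 'a"
  assumes lin: "linear f" and sa: "\<And>x y. f x \<bullet> y = x \<bullet> f y"
    and V: "subspace V" "f ` V \<subseteq> V" "V \<noteq> {0}"
  obtains v c where "v \<in> V" "norm v = 1" "f v = c *\<^sub>R v"
proof -
  let ?K = "V \<inter> sphere 0 1"
  obtain u where u: "u \<in> V" "u \<noteq> 0" using V subspace_0 by blast
  then have "u /\<^sub>R norm u \<in> ?K" using V(1) by (simp add: subspace_scale)
  then have "?K \<noteq> {}" by blast
  moreover have "compact ?K" using closed_subspace[OF V(1)] by (simp add: closed_Int_compact)
  moreover have "continuous_on ?K (\<lambda>x. x \<bullet> f x)"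
    by (intro continuous_intros linear_continuous_on linear_linear[THEN iffD1] lin)
      (simp add: lin linear_conv_bounded_linear[symmetric])
  ultimately obtain v where v: "v \<in> V" "norm v = 1"
    and max: "\<And>x. x \<in> V \<Longrightarrow> norm x = 1 \<Longrightarrow> x \<bullet> f x \<le> v \<bullet> f v"
    using continuous_attains_sup[of ?K "\<lambda>x. x \<bullet> f x"] by (metis Int_iff mem_sphere_0)
  define c where "c = v \<bullet> f v"
  have le: "x \<bullet> f x \<le> c * (x \<bullet> x)" if "x \<in> V" for x
  proof (cases "x = 0")
    case True then show ?thesis by (simp add: linear_0[OF lin])
  next
    case False
    have "(x /\<^sub>R norm x) \<bullet> f (x /\<^sub>R norm x) \<le> c"
      unfolding c_def by (rule max) (use that False V(1) in \<open>auto simp: subspace_scale\<close>)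
    moreover have "(x /\<^sub>R norm x) \<bullet> f (x /\<^sub>R norm x) = (x \<bullet> f x) / (norm x)\<^sup>2"
      by (simp add: linear_scale[OF lin] power2_eq_square field_simps)
    ultimately show ?thesis using False by (simp add: divide_le_eq power2_norm_eq_inner)
  qed
  define w where "w = f v - c *\<^sub>R v"
  have wV: "w \<in> V" unfolding w_def using v V by (auto intro!: subspace_diff subspace_scale)
  have vw: "v \<bullet> w = 0"
    using v(2) by (simp add: w_def inner_diff_right c_def norm_eq_1)
  have vfw: "v \<bullet> f w = w \<bullet> w"
  proof -
    have "v \<bullet> f w = f v \<bullet> w" by (simp add: sa)
    also have "\<dots> = (w + c *\<^sub>R v) \<bullet> w" by (simp add: w_def)
    finally show ?thesis by (simp add: inner_add_left vw)
  qed
  \<comment> \<open>\<open>q\<close> collects the second-order terms in t when maximality is tested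
    at v + t w; the first-order term is 2 t (w . w).\<close>
  define q where "q = c * (w \<bullet> w) - w \<bullet> f w"
  have main: "2 * t * (w \<bullet> w) \<le> t\<^sup>2 * q" for t
  proof -
    have "(v + t *\<^sub>R w) \<bullet> f (v + t *\<^sub>R w) \<le> c * ((v + t *\<^sub>R w) \<bullet> (v + t *\<^sub>R w))"
      by (rule le) (use v wV V(1) in \<open>auto intro!: subspace_add subspace_scale\<close>)
    moreover have "w \<bullet> f v = v \<bullet> f w" using sa[of v w] by (simp add: inner_commute)
    ultimately have "c + 2 * t * (v \<bullet> f w) + t\<^sup>2 * (w \<bullet> f w) \<le> c * (1 + t\<^sup>2 * (w \<bullet> w))"
      using v(2) vw
      by (simp add: linear_add[OF lin] linear_scale[OF lin] inner_add_left inner_add_right c_def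
          algebra_simps power2_eq_square norm_eq_1 inner_commute[of w v])
    then show ?thesis by (simp add: q_def vfw algebra_simps)
  qed
  have "w \<bullet> w \<le> 0"
  \<comment> \<open>For q > 0 the test value t = |w|^2 / q gives 2 |w|^4 / q \<le> |w|^4 / q;
    otherwise t = 1 already forces w = 0.\<close>
  proof (cases "q > 0")
    case True
    have "2 * ((w \<bullet> w) / q) * (w \<bullet> w) \<le> ((w \<bullet> w) / q)\<^sup>2 * q" by (rule main)
    then show ?thesis using True
      by (simp add: power2_eq_square field_simps mult_le_0_iff)
  next
    case False then show ?thesis using main[of 1] by simp
  qed
  then have "w = 0" by (metis inner_eq_zero_iff inner_ge_zero order_antisym)
  with v that show thesis by (simp add: w_def)
qed

text \<open>Induction on the dimension: self-adjointness makes the orthogonal complement of an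
  eigenvector inside V invariant again.\<close>

lemma selfadjoint_eigenbasis:
  fixes f :: "'a::euclidean_space \<Rightarrow> 'a"
  assumes lin: "linear f" and sa: "\<And>x y. f x \<bullet> y = x \<bullet> f y"
    and V: "subspace V" "f ` V \<subseteq> V"
  shows "\<exists>B. finite B \<and> B \<subseteq> V \<and> span B = V \<and> (\<forall>a\<in>B. \<forall>b\<in>B. a \<bullet> b = of_bool (a = b))
    \<and> (\<forall>b\<in>B. \<exists>c. f b = c *\<^sub>R b)"
  using V
proof (induction "dim V" arbitrary: V rule: less_induct)
  case less
  show ?case
  proof (cases "V = {0}")
    case True
    then show ?thesis by (intro exI[of _ "{}"]) auto
  next
    case False
    obtain v c where v: "v \<in> V" "norm v = 1" "f v = c *\<^sub>R v"
      using selfadjoint_eigenvector[OF lin sa less.prems False] by blast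
    let ?W = "V \<inter> {x. v \<bullet> x = 0}"
    have W: "subspace ?W" using subspace_inter[OF less.prems(1) subspace_hyperplane] .
    have fW: "f ` ?W \<subseteq> ?W" using less.prems v by (auto simp flip: sa)
    have "v \<notin> ?W" using v(2) by auto
    then have "?W \<subset> V" using v(1) by blast
    then have "dim ?W < dim V" using W less.prems(1) by (metis dim_psubset span_eq_iff)
    from less.hyps[OF this W fW] obtain B where B: "finite B" "B \<subseteq> ?W" "span B = ?W"
      "\<forall>a\<in>B. \<forall>b\<in>B. a \<bullet> b = of_bool (a = b)" "\<forall>b\<in>B. \<exists>c. f b = c *\<^sub>R b" by blast
    have "x \<in> span (insert v B)" if "x \<in> V" for x
    proof -
      have "x - (v \<bullet> x) *\<^sub>R v \<in> ?W"
        using that v less.prems(1) by (auto intro!: subspace_diff subspace_scale simp: inner_diff_right norm_eq_1)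
      then have "x - (v \<bullet> x) *\<^sub>R v \<in> span B" using B by simp
      then show ?thesis using span_insert by blast
    qed
    moreover have "span (insert v B) \<subseteq> V"
      using B v less.prems(1) by (intro span_minimal) auto
    ultimately have "span (insert v B) = V" by blast
    moreover have "\<forall>a\<in>insert v B. \<forall>b\<in>insert v B. a \<bullet> b = of_bool (a = b)"
      using B v(2) by (auto simp: norm_eq_1 inner_commute)
    ultimately show ?thesis using B v by (intro exI[of _ "insert v B"]) auto
  qed
qed

section \<open>Positive definite matrices and their roots\<close>

lemma pdD:
  assumes "pd A"
  shows "transpose A = A" "x \<noteq> 0 \<Longrightarrow> x \<bullet> (A *v x) > 0"
  using assms by (auto simp: pd_def)

lemma pd_invertible:
  assumes "pd A" shows "invertible A"
  using pdD(2)[OF assms] by (force simp: invertible_iff_ker)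

lemma pd_matrix_inv:
  assumes "pd A" shows "pd (matrix_inv A)"
proof -
  note inv = pd_invertible[OF assms]
  have "transpose (matrix_inv A) = matrix_inv A"
    using matrix_inv_transpose[OF inv] pdD(1)[OF assms] by simp
  moreover have "x \<bullet> (matrix_inv A *v x) > 0" if "x \<noteq> 0" for x
  proof -
    let ?y = "matrix_inv A *v x"
    have "?y \<noteq> 0" using that matrix_inv_mult_vec(1)[OF inv, of x] by auto
    then have "?y \<bullet> (A *v ?y) > 0" by (rule pdD(2)[OF assms])
    then show ?thesis by (simp add: matrix_inv_mult_vec[OF inv] inner_commute)
  qed
  ultimately show ?thesis by (simp add: pd_def)
qed

lemma pd_congruence:
  fixes X :: "real^'n^'m"
  assumes "pd A" and inj: "\<And>x. X *v x = 0 \<Longrightarrow> x = 0"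
  shows "pd (transpose X ** A ** X)"
proof -
  have "x \<bullet> ((transpose X ** A ** X) *v x) = (X *v x) \<bullet> (A *v (X *v x))" for x
    by (simp add: inner_matrix_vector flip: matrix_vector_mul_assoc)
  then show ?thesis
    using pdD[OF assms(1)] inj
    by (auto simp: pd_def matrix_transpose_mul matrix_mul_assoc)
qed

text \<open>Existence takes square roots of the eigenvalues in an orthonormal eigenbasis. Uniqueness
  shows that any positive definite root has the same action on each basis vector. Both are required
  to unfold \<open>msqrt\<close>.\<close>

lemma pd_ex1_sqrt:
  fixes A :: "real^'n^'n"
  assumes "pd A"
  shows "\<exists>!B. pd B \<and> B ** B = A"
proof -
  have sa: "(A *v x) \<bullet> y = x \<bullet> (A *v y)" for x y
    by (simp add: inner_matrix_vector pdD(1)[OF assms])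
  obtain E where E: "finite E" "span E = UNIV"
      "\<And>a b. a \<in> E \<Longrightarrow> b \<in> E \<Longrightarrow> a \<bullet> b = of_bool (a = b)" "\<forall>b\<in>E. \<exists>c. A *v b = c *\<^sub>R b"
    using selfadjoint_eigenbasis[OF matrix_vector_mul_linear[of A] sa subspace_UNIV subset_UNIV]
    by (elim exE conjE) simp
  from E(4) obtain l where l: "\<And>b. b \<in> E \<Longrightarrow> A *v b = l b *\<^sub>R b" by metis
  have lpos: "l b > 0" if "b \<in> E" for b
    using pdD(2)[OF assms, of b] E(3)[OF that that] by (force simp: l[OF that])
  define g where "g x = (\<Sum>b\<in>E. (sqrt (l b) * (b \<bullet> x)) *\<^sub>R b)" for x
  have lg: "linear g"
    by (rule linearI) (simp_all add: g_def inner_add_right algebra_simps sum.distrib scaleR_sum_right)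
  have gb: "g b = sqrt (l b) *\<^sub>R b" if "b \<in> E" for b
  proof -
    have "g b = (\<Sum>a\<in>E. if a = b then sqrt (l b) *\<^sub>R b else 0)"
      unfolding g_def by (rule sum.cong) (auto simp: E(3) that)
    then show ?thesis using E(1) that by simp
  qed
  let ?G = "matrix g"
  have G: "?G *v x = g x" for x using lg by (simp add: linear_matrix_vector_mul_eq matrix_works)
  have ginner: "y \<bullet> g x = (\<Sum>b\<in>E. sqrt (l b) * (b \<bullet> x) * (b \<bullet> y))" for x y
    by (simp add: g_def inner_sum_right inner_commute)
  have "pd ?G"
    unfolding pd_def
  proof (intro conjI allI impI)
    have "y \<bullet> (transpose ?G *v x) = y \<bullet> (?G *v x)" for x y
    proof -
      have "y \<bullet> (transpose ?G *v x) = x \<bullet> g y"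
        using inner_matrix_vector[of x ?G y] by (simp add: G inner_commute)
      also have "\<dots> = y \<bullet> g x" by (simp add: ginner mult.assoc mult.commute[of "_ \<bullet> x"])
      finally show ?thesis by (simp add: G)
    qed
    then show "transpose ?G = ?G" unfolding matrix_eq by (meson vector_eq_ldot)
  next
    fix x :: "real^'n" assume "x \<noteq> 0"
    have "\<exists>b\<in>E. b \<bullet> x \<noteq> 0"
    proof (rule ccontr)
      assume "\<not> ?thesis"
      then have "orthogonal x y" if "y \<in> span E" for y
        by (intro orthogonal_to_span[OF that]) (auto simp: orthogonal_def inner_commute)
      then show False using E(2) \<open>x \<noteq> 0\<close> by (metis UNIV_I orthogonal_self)
    qed
    then obtain b where b: "b \<in> E" "b \<bullet> x \<noteq> 0" by blast
    have "0 < (\<Sum>b\<in>E. sqrt (l b) * (b \<bullet> x) * (b \<bullet> x))"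
    proof (rule sum_pos2[OF E(1) b(1)])
      have "0 < (b \<bullet> x) * (b \<bullet> x)" using b by (simp add: zero_less_mult_iff linorder_neq_iff) linarith
      then show "0 < sqrt (l b) * (b \<bullet> x) * (b \<bullet> x)"
        using lpos[OF b(1)] by (simp add: mult.assoc)
    qed (use lpos in \<open>simp add: less_imp_le mult.assoc\<close>)
    then show "x \<bullet> (?G *v x) > 0" by (simp add: G ginner)
  qed
  moreover have "?G ** ?G = A"
  proof -
    have "g (g x) = A *v x" for x
    proof (rule linear_eq_on_span[of "g \<circ> g" "\<lambda>x. A *v x" E, unfolded o_def])
      show "linear (\<lambda>x. g (g x))" using linear_compose[OF lg lg] by (simp add: o_def)
      show "g (g b) = A *v b" if "b \<in> E" for b
        using lpos[OF that] by (simp add: gb that linear_scale[OF lg] l)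
    qed (auto simp: E(2))
    then show ?thesis by (simp add: matrix_eq G flip: matrix_vector_mul_assoc)
  qed
  moreover have "B = ?G" if "pd B" "B ** B = A" for B
  proof -
    have "B *v x = g x" for x
    proof (rule linear_eq_on_span[of "\<lambda>x. B *v x" g E])
      fix b assume b: "b \<in> E"
      \<comment> \<open>Since B squared is A, (B + sqrt l)(B - sqrt l) b = 0. So \<open>?w\<close>
        would be an eigenvector of B with negative eigenvalue, which positivity excludes unless it
        vanishes.\<close>
      let ?w = "B *v b - sqrt (l b) *\<^sub>R b"
      have "B *v ?w = - sqrt (l b) *\<^sub>R ?w"
        using lpos[OF b] l[OF b]
        by (simp add: matrix_vector_mult_diff_distrib matrix_vector_mul_assoc that(2)
             matrix_vector_mult_scaleR algebra_simps)
      then have "?w \<bullet> (B *v ?w) = - (sqrt (l b) * (?w \<bullet> ?w))" by (metis inner_scaleR_right mult_minus_left)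
      also have "\<dots> \<le> 0" using lpos[OF b] by simp
      finally have "?w = 0" using pdD(2)[OF that(1), of ?w] by force
      then show "B *v b = g b" by (simp add: gb b)
    qed (auto simp: E(2) lg)
    then show ?thesis by (simp add: matrix_eq G)
  qed
  ultimately show ?thesis by blast
qed

lemma pd_msqrt: "pd A \<Longrightarrow> pd (msqrt A)"
  and msqrt_square: "pd A \<Longrightarrow> msqrt A ** msqrt A = A"
  unfolding msqrt_def using theI'[OF pd_ex1_sqrt] by blast+

lemma invertible_msqrt: "pd A \<Longrightarrow> invertible (msqrt A)"
  by (simp add: pd_msqrt pd_invertible)

lemma pd_misqrt: "pd A \<Longrightarrow> pd (misqrt A)"
  by (simp add: misqrt_def pd_msqrt pd_matrix_inv)

lemma misqrt_msqrt: "pd A \<Longrightarrow> misqrt A ** msqrt A = mat 1" "pd A \<Longrightarrow> msqrt A ** misqrt A = mat 1"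
  by (simp_all add: misqrt_def matrix_inv_mult invertible_msqrt)

lemma misqrt_square: "pd A \<Longrightarrow> misqrt A ** misqrt A = matrix_inv A"
  using matrix_inv_product[OF invertible_msqrt invertible_msqrt, of A A]
  by (simp add: misqrt_def msqrt_square)

lemma misqrt_sandwich: "pd A \<Longrightarrow> misqrt A ** A ** misqrt A = mat 1"
  by (metis matrix_mul_assoc matrix_mul_lid misqrt_msqrt msqrt_square)

lemma pd_det_pos:
  assumes "pd A" shows "det A > 0"
proof -
  have "det A = (det (msqrt A))\<^sup>2"
    using msqrt_square[OF assms] by (metis det_mul power2_eq_square)
  then show ?thesis using invertible_msqrt[OF assms] by (simp add: invertible_det_nz)
qed

text \<open>The form is |N x|^2 for the square root N, and an injective linear map is bounded below.
  This bound is the source of the Gaussian decay of the likelihood.\<close>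

lemma pd_lower_bound:
  fixes A :: "real^'n^'n"
  assumes "pd A"
  obtains l where "l > 0" "\<And>x. l * (x \<bullet> x) \<le> x \<bullet> (A *v x)"
proof -
  let ?N = "msqrt A"
  have q: "x \<bullet> (A *v x) = (norm (?N *v x))\<^sup>2" for x
  proof -
    have "x \<bullet> (A *v x) = x \<bullet> (?N *v (?N *v x))"
      by (simp add: matrix_vector_mul_assoc msqrt_square assms)
    also have "\<dots> = (norm (?N *v x))\<^sup>2"
      using inner_matrix_vector[of x ?N "?N *v x"]
      by (simp add: pdD(1)[OF pd_msqrt[OF assms]] power2_norm_eq_inner)
    finally show ?thesis .
  qed
  have "inj (\<lambda>x. ?N *v x)"
    using invertible_msqrt[OF assms] by (simp add: inj_matrix_vector_mult)
  then obtain b where b: "b > 0" "\<And>x. b * norm x \<le> norm (?N *v x)"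
    using linear_inj_bounded_below_pos[OF matrix_vector_mul_linear] by blast
  have "b\<^sup>2 * (x \<bullet> x) \<le> x \<bullet> (A *v x)" for x
    using power_mono[OF b(2)[of x], of 2] b(1) by (simp add: q power_mult_distrib power2_norm_eq_inner)
  then show thesis using b(1) that[of "b\<^sup>2"] by simp
qed

text \<open>Whitening with the symmetric square root is equivariant only up to a rotation.\<close>
lemma orthogonal_matrix_whitened:
  fixes P Y :: "real^'n^'n"
  assumes "pd P" "invertible Y" "pd Q" "Q = Y ** P ** transpose Y"
  shows "orthogonal_matrix (misqrt Q ** Y ** msqrt P)"
proof -
  let ?O = "misqrt Q ** Y ** msqrt P"
  have "?O ** transpose ?O = misqrt Q ** (Y ** (msqrt P ** msqrt P) ** transpose Y) ** misqrt Q"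
    by (simp add: matrix_transpose_mul pdD(1)[OF pd_msqrt[OF assms(1)]] pdD(1)[OF pd_misqrt[OF assms(3)]] matrix_mul_assoc)
  also have "\<dots> = mat 1"
    by (simp add: msqrt_square assms(1,3) misqrt_sandwich flip: assms(4))
  finally show ?thesis
    by (metis orthogonal_matrix_def matrix_left_right_inverse)
qed

section \<open>Linear substitution and Gaussian integrals\<close>

lemma prod_Basis_vec:
  fixes f :: "real^'n \<Rightarrow> real"
  shows "(\<Prod>b\<in>Basis. f b) = (\<Prod>i\<in>UNIV. f (axis i 1))"
proof -
  have B: "(Basis :: (real^'n) set) = range (\<lambda>i. axis i 1)" by (auto simp: Basis_vec_def)
  show ?thesis unfolding B by (subst prod.reindex) (simp_all add: inj_on_def axis_eq_axis)
qed

lemma borel_measurable_matrix_vector [measurable (raw)]: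
  fixes A :: "real^'n^'m"
  assumes "f \<in> borel_measurable M"
  shows "(\<lambda>x. A *v f x) \<in> borel_measurable M"
  by (rule borel_measurable_continuous_on[OF _ assms])
    (simp add: linear_continuous_on linear_conv_bounded_linear[symmetric])

text \<open>Reduces to the coordinatewise rescaling of Lebesgue measure; \<open>c\<close> is the
  diagonal read as a function on \<open>Basis\<close>.\<close>

lemma nn_integral_lborel_diagonal:
  fixes A :: "real^'n^'n"
  assumes A: "\<And>i j. i \<noteq> j \<Longrightarrow> A $ i $ j = 0" "det A \<noteq> 0"
    and [measurable]: "f \<in> borel_measurable borel"
  shows "ennreal \<bar>det A\<bar> * (\<integral>\<^sup>+x. f (A *v x) \<partial>lborel) = integral\<^sup>N lborel f"
proof -
  have d: "det A = (\<Prod>i\<in>UNIV. A $ i $ i)" by (rule det_diagonal[OF A(1)])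
  define c where "c j = (A *v j) \<bullet> j" for j
  have ca: "c (axis i 1) = A $ i $ i" for i
    by (simp add: c_def inner_axis matrix_vector_mult_basis column_def)
  have c0: "c j \<noteq> 0" if "j \<in> Basis" for j
    using that A(2) by (auto simp: Basis_vec_def ca d)
  have Av: "(A *v x) $ i = A $ i $ i * x $ i" for x i
  proof -
    have "(A *v x) $ i = (\<Sum>j\<in>UNIV. if j = i then A $ i $ i * x $ i else 0)"
      unfolding matrix_vector_mult_def vec_lambda_beta by (rule sum.cong) (auto simp: A(1))
    then show ?thesis by simp
  qed
  have T: "0 + (\<Sum>j\<in>Basis. (c j * (x \<bullet> j)) *\<^sub>R j) = A *v x" for x
  proof (rule euclidean_eqI)
    fix b :: "real^'n" assume b: "b \<in> Basis"
    then obtain i where "b = axis i 1" by (auto simp: Basis_vec_def)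
    then show "(0 + (\<Sum>j\<in>Basis. (c j * (x \<bullet> j)) *\<^sub>R j)) \<bullet> b = (A *v x) \<bullet> b"
      using b by (simp add: inner_sum_left inner_Basis if_distrib sum.delta cong: if_cong)
        (simp add: inner_axis ca Av)
  qed
  have "integral\<^sup>N lborel f
      = integral\<^sup>N (density (distr lborel borel (\<lambda>x. A *v x)) (\<lambda>_. ennreal (\<Prod>j\<in>Basis. \<bar>c j\<bar>))) f"
    using lborel_affine_euclidean[of c 0, unfolded T] c0 by simp
  also have "(\<Prod>j\<in>Basis. \<bar>c j\<bar>) = \<bar>det A\<bar>" by (simp add: prod_Basis_vec ca d abs_prod)
  also have "integral\<^sup>N (density (distr lborel borel (\<lambda>x. A *v x)) (\<lambda>_. ennreal \<bar>det A\<bar>)) f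
      = ennreal \<bar>det A\<bar> * (\<integral>\<^sup>+x. f (A *v x) \<partial>lborel)"
    by (simp add: nn_integral_density nn_integral_cmult nn_integral_distr)
  finally show ?thesis by simp
qed

text \<open>The preimage of a box is the box with permuted corners, and the product of its side
  lengths does not depend on their order.\<close>

lemma nn_integral_lborel_permute:
  fixes f :: "real^'n \<Rightarrow> ennreal"
  assumes p: "p permutes UNIV" and [measurable]: "f \<in> borel_measurable borel"
  shows "(\<integral>\<^sup>+x. f (\<chi> i. x $ p i) \<partial>lborel) = integral\<^sup>N lborel f"
proof -
  let ?T = "\<lambda>x::real^'n. \<chi> i. x $ p i"
  let ?U = "\<lambda>x::real^'n. \<chi> i. x $ inv p i"
  have "linear ?T" by (rule linearI) (simp_all add: vec_eq_iff)
  then have [measurable]: "?T \<in> borel \<rightarrow>\<^sub>M borel"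
    by (simp add: borel_measurable_continuous_onI linear_continuous_on linear_conv_bounded_linear)
  have "lborel = distr lborel borel ?T"
  proof (rule lborel_eqI)
    fix l u :: "real^'n" assume le: "\<And>b. b \<in> Basis \<Longrightarrow> l \<bullet> b \<le> u \<bullet> b"
    then have le': "l $ i \<le> u $ i" for i by (metis axis_in_Basis_iff cart_eq_inner_axis Basis_real_def insertI1)
    have pre: "?T -` box l u = box (?U l) (?U u)"
      unfolding set_eq_iff vimage_eq mem_box_cart
      by (simp add: ) (metis permutes_inverses[OF p])
    have "emeasure (distr lborel borel ?T) (box l u) = emeasure lborel (box (?U l) (?U u))"
      by (simp add: emeasure_distr pre)
    also have "\<dots> = ennreal (\<Prod>i\<in>UNIV. (u - l) $ inv p i)"
      by (subst emeasure_lborel_box) (simp add: Basis_vec_def, force simp: inner_axis le', simp add: prod_Basis_vec inner_axis)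
    also have "(\<Prod>i\<in>UNIV. (u - l) $ inv p i) = (\<Prod>i\<in>UNIV. (u - l) $ i)"
      using prod.permute[OF permutes_inv[OF p], of "\<lambda>i. (u - l) $ i"] by (simp add: o_def)
    finally show "emeasure (distr lborel borel ?T) (box l u) = (\<Prod>b\<in>Basis. (u - l) \<bullet> b)"
      by (simp add: prod_Basis_vec inner_axis)
  qed simp
  then have "integral\<^sup>N lborel f = integral\<^sup>N (distr lborel borel ?T) f" by simp
  then show ?thesis by (simp add: nn_integral_distr)
qed

text \<open>By Fubini with coordinate b innermost: along each line in direction b the displacement
  \<open>g\<close> is constant, so the inner integral is merely translated.\<close>

lemma nn_integral_lborel_shear:
  fixes f :: "'a::euclidean_space \<Rightarrow> ennreal"
  assumes b: "b \<in> Basis" and g: "\<And>x y. g (x + y *\<^sub>R b) = (g x :: real)"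
    and [measurable]: "g \<in> borel_measurable borel" "f \<in> borel_measurable borel"
  shows "(\<integral>\<^sup>+x. f (x + g x *\<^sub>R b) \<partial>lborel) = integral\<^sup>N lborel f"
proof -
  interpret product_sigma_finite "\<lambda>_::'a. lborel :: real measure" ..
  let ?B = "Basis - {b}" and ?v = "\<lambda>x. \<Sum>j\<in>Basis. x j *\<^sub>R j"
  have B: "insert b ?B = (Basis :: 'a set)" using b by blast
  have [measurable]: "?v \<in> borel_measurable (Pi\<^sub>M Basis (\<lambda>_. lborel))" by measurable
  have upd: "?v (x(b := y)) = (\<Sum>j\<in>?B. x j *\<^sub>R j) + y *\<^sub>R b" for x y
    by (subst sum.remove[OF finite_Basis b]) (auto intro!: sum.cong)
  have fub: "integral\<^sup>N lborel h = (\<integral>\<^sup>+ x. (\<integral>\<^sup>+ y. h ((\<Sum>j\<in>?B. x j *\<^sub>R j) + y *\<^sub>R b) \<partial>lborel)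
      \<partial>(Pi\<^sub>M ?B (\<lambda>_. lborel)))"
    if [measurable]: "h \<in> borel_measurable borel" for h
  proof -
    have "integral\<^sup>N lborel h = (\<integral>\<^sup>+ x. h (?v x) \<partial>(Pi\<^sub>M (insert b ?B) (\<lambda>_. lborel)))"
      unfolding B by (subst (1) lborel_def) (simp add: nn_integral_distr lborel_eq_real[symmetric])
    also have "\<dots> = (\<integral>\<^sup>+ x. (\<integral>\<^sup>+ y. h (?v (x(b := y))) \<partial>lborel) \<partial>(Pi\<^sub>M ?B (\<lambda>_. lborel)))"
      by (rule product_nn_integral_insert) (simp_all add: B)
    finally show ?thesis by (simp only: upd)
  qed
  have "(\<integral>\<^sup>+ y. f ((w + y *\<^sub>R b) + g (w + y *\<^sub>R b) *\<^sub>R b) \<partial>lborel) = (\<integral>\<^sup>+ y. f (w + y *\<^sub>R b) \<partial>lborel)" for w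
    using nn_integral_real_affine[of "\<lambda>y. f (w + y *\<^sub>R b)" 1 "g w"]
    by (simp add: g scaleR_add_left add_ac)
  then show ?thesis by (subst (1 2) fub) simp_all
qed

text \<open>Induction over products of elementary matrices. The quantifier over f sits inside the
  claim because the product step applies one hypothesis to the composition of f with A.\<close>

lemma nn_integral_lborel_linear_aux:
  fixes A :: "real^'n^'n"
  shows "det A \<noteq> 0 \<longrightarrow> (\<forall>f\<in>borel_measurable borel.
    ennreal \<bar>det A\<bar> * (\<integral>\<^sup>+x. f (A *v x) \<partial>lborel) = integral\<^sup>N lborel f)" (is "?P A")
proof (induction A rule: induct_matrix_elementary_alt)
  fix A B assume A: "?P A" and B: "?P B"
  show "?P (A ** B)"
  proof (intro impI ballI)
    fix f :: "real^'n \<Rightarrow> ennreal" assume [measurable]: "f \<in> borel_measurable borel"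
    assume "det (A ** B) \<noteq> 0"
    then have "det A \<noteq> 0" "det B \<noteq> 0" by (auto simp: det_mul)
    have fA: "(\<lambda>x. f (A *v x)) \<in> borel_measurable borel" by measurable
    have "ennreal \<bar>det (A ** B)\<bar> * (\<integral>\<^sup>+x. f ((A ** B) *v x) \<partial>lborel)
       = ennreal \<bar>det A\<bar> * (ennreal \<bar>det B\<bar> * (\<integral>\<^sup>+x. f (A *v (B *v x)) \<partial>lborel))"
      by (simp add: det_mul abs_mult ennreal_mult mult.assoc matrix_vector_mul_assoc)
    also have "\<dots> = ennreal \<bar>det A\<bar> * (\<integral>\<^sup>+x. f (A *v x) \<partial>lborel)"
      using B[rule_format, OF \<open>det B \<noteq> 0\<close> fA] by simp
    also have "\<dots> = integral\<^sup>N lborel f" using A \<open>det A \<noteq> 0\<close> by auto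
    finally show "ennreal \<bar>det (A ** B)\<bar> * (\<integral>\<^sup>+x. f ((A ** B) *v x) \<partial>lborel) = integral\<^sup>N lborel f" .
  qed
next
  fix A :: "real^'n^'n" and i assume "row i A = 0"
  \<comment> \<open>A zero row makes the determinant vanish, so the implication is vacuous.\<close>
  then show "?P A" using det_zero_row(2) by blast
next
  fix A :: "real^'n^'n" assume "\<And>i j. i \<noteq> j \<Longrightarrow> A $ i $ j = 0"
  then show "?P A" using nn_integral_lborel_diagonal by blast
next
  fix m n :: 'n assume "m \<noteq> n"
  let ?p = "Transposition.transpose m n"
  let ?A = "(\<chi> i j. mat 1 $ i $ ?p j) :: real^'n^'n"
  have p: "?p permutes UNIV" by (simp add: permutes_swap_id)
  have "?A *v x = (\<chi> i. x $ ?p i)" for x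
  proof -
    have "(\<Sum>j\<in>UNIV. mat 1 $ i $ ?p j * x $ j) = (\<Sum>j\<in>UNIV. if j = ?p i then x $ j else 0)" for i
      by (rule sum.cong) (auto simp: mat_def)
    then show ?thesis by (simp add: vec_eq_iff matrix_vector_mult_def)
  qed
  moreover have "\<bar>det ?A\<bar> = 1"
    by (simp add: det_permute_columns p sign_swap_id abs_mult)
  ultimately show "?P ?A" using nn_integral_lborel_permute[OF p] by simp
next
  fix m n :: 'n assume mn: "m \<noteq> n"
  let ?A = "(\<chi> i j. of_bool (i = m \<and> j = n \<or> i = j)) :: real^'n^'n"
  have "?A *v x = x + x $ n *\<^sub>R axis m 1" for x
  proof -
    have "(\<Sum>j\<in>UNIV. of_bool (i = m \<and> j = n \<or> i = j) * x $ j)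
        = (\<Sum>j\<in>UNIV. (if j = n then of_bool (i = m) * x $ n else 0) + (if j = i then x $ i else 0))" for i
      using mn by (intro sum.cong) auto
    then show ?thesis by (simp add: vec_eq_iff matrix_vector_mult_def sum.distrib axis_def)
  qed
  moreover have "det ?A = 1"
  proof -
    have "?A = (\<chi> k. if k = m then row m (mat 1) + 1 *s row n (mat 1) else row k (mat 1))"
      using mn by (auto simp: vec_eq_iff row_def mat_def)
    then show ?thesis using det_row_operation[OF mn, of "mat 1 :: real^'n^'n" 1] by simp
  qed
  moreover have "(\<integral>\<^sup>+x. f (x + x $ n *\<^sub>R axis m 1) \<partial>lborel) = integral\<^sup>N lborel f"
    if "f \<in> borel_measurable borel" for f
    using that mn by (intro nn_integral_lborel_shear) (simp_all add: axis_in_Basis_iff, simp add: axis_def)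
  ultimately show "?P ?A" by simp
qed

lemma nn_integral_lborel_linear:
  fixes A :: "real^'n^'n"
  assumes "invertible A" and "f \<in> borel_measurable borel"
  shows "integral\<^sup>N lborel f = ennreal \<bar>det A\<bar> * (\<integral>\<^sup>+x. f (A *v x) \<partial>lborel)"
  using nn_integral_lborel_linear_aux[of A] assms by (simp add: invertible_det_nz)

lemma nn_integral_lborel_shift:
  fixes f :: "'a::euclidean_space \<Rightarrow> ennreal"
  assumes "f \<in> borel_measurable borel"
  shows "(\<integral>\<^sup>+x. f (x + a) \<partial>lborel) = integral\<^sup>N lborel f"
  using assms lborel_distr_plus[of a] nn_integral_distr[of "(+) a" lborel borel f]
  by (simp add: add.commute)

section \<open>Gaussian integrals in several variables\<close>

lemma nn_integral_std_gaussian: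
  "(\<integral>\<^sup>+x. ennreal (exp (- (x \<bullet> x) / 2)) \<partial>(lborel :: (real^'n) measure)) = ennreal ((2 * pi) powr (real CARD('n) / 2))"
proof -
  have e: "exp (- (x \<bullet> x) / 2) = (\<Prod>b\<in>Basis. exp (- (x \<bullet> b)\<^sup>2 / 2))" for x :: "real^'n"
  proof -
    have "- (x \<bullet> x) / 2 = (\<Sum>b\<in>Basis. - (x \<bullet> b)\<^sup>2 / 2)"
      by (subst euclidean_inner) (simp add: power2_eq_square sum_negf sum_divide_distrib)
    then show ?thesis by (simp add: exp_sum)
  qed
  have one: "(\<integral>\<^sup>+(x::real). ennreal (exp (- x\<^sup>2 / 2)) \<partial>lborel) = ennreal (sqrt (2 * pi))"
  proof -
    have "exp (- x\<^sup>2 / 2) = sqrt (2 * pi) * std_normal_density x" for x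
      by (simp add: std_normal_density_def)
    then have "(\<integral>\<^sup>+(x::real). ennreal (exp (- x\<^sup>2 / 2)) \<partial>lborel)
        = ennreal (sqrt (2 * pi)) * (\<integral>\<^sup>+x. ennreal (std_normal_density x) \<partial>lborel)"
      by (simp add: ennreal_mult nn_integral_cmult)
    also have "(\<integral>\<^sup>+x. ennreal (std_normal_density x) \<partial>lborel) = 1"
      using prob_space.emeasure_space_1[OF prob_space_normal_density[of 1 0]]
      by (simp add: emeasure_density)
    finally show ?thesis by simp
  qed
  have "(\<integral>\<^sup>+(x::real^'n). ennreal (exp (- (x \<bullet> x) / 2)) \<partial>lborel)
      = (\<integral>\<^sup>+(x::real^'n). (\<Prod>b\<in>Basis. ennreal (exp (- (x \<bullet> b)\<^sup>2 / 2))) \<partial>lborel)"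
    unfolding e by (simp add: prod_ennreal)
  also have "\<dots> = (\<Prod>b\<in>(Basis::(real^'n) set). ennreal (sqrt (2 * pi)))"
    by (subst nn_integral_lborel_prod) (simp_all only: one, simp_all)
  also have "\<dots> = ennreal ((2 * pi) powr (real CARD('n) / 2))"
    by (simp add: ennreal_power powr_half_sqrt[symmetric] powr_powr powr_realpow[symmetric])
  finally show ?thesis .
qed

text \<open>Complete the square: with \<open>N = msqrt M\<close> the exponent is
  \<open>- |N m - N\<inverse> b|\<^sup>2 / 2 + b \<bullet> M\<inverse> b / 2\<close>.\<close>
lemma nn_integral_gaussian:
  fixes M :: "real^'n^'n"
  assumes M: "pd M"
  shows "(\<integral>\<^sup>+x. ennreal (exp (b \<bullet> x - (x \<bullet> (M *v x)) / 2)) \<partial>lborel)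
    = ennreal ((2 * pi) powr (real CARD('n) / 2) * det M powr (-1/2) * exp (b \<bullet> (matrix_inv M *v b) / 2))"
proof -
  let ?N = "msqrt M" and ?I = "misqrt M"
  let ?G = "\<lambda>x::real^'n. ennreal (exp (- (x \<bullet> x) / 2))"
  have sym: "transpose ?N = ?N" "transpose ?I = ?I"
    using M by (simp_all add: pdD pd_msqrt pd_misqrt)
  have NN: "(?N *v x) \<bullet> (?N *v x) = x \<bullet> (M *v x)" for x
    using inner_matrix_vector[of x ?N "?N *v x"]
    by (simp add: sym matrix_vector_mul_assoc msqrt_square M)
  have NI: "(?N *v x) \<bullet> (?I *v b) = b \<bullet> x" for x
    using inner_matrix_vector[of "?N *v x" ?I b]
    by (simp add: sym matrix_vector_mul_assoc misqrt_msqrt M inner_commute)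
  have II: "(?I *v b) \<bullet> (?I *v b) = b \<bullet> (matrix_inv M *v b)"
    using inner_matrix_vector[of b ?I "?I *v b"]
    by (simp add: sym matrix_vector_mul_assoc misqrt_square M)
  let ?c = "exp (b \<bullet> (matrix_inv M *v b) / 2)"
  have "b \<bullet> x - (x \<bullet> (M *v x)) / 2 = b \<bullet> (matrix_inv M *v b) / 2
      + - ((?N *v x + - (?I *v b)) \<bullet> (?N *v x + - (?I *v b))) / 2" for x
    unfolding inner_add_left inner_add_right inner_minus_left inner_minus_right NN NI II
      inner_commute[of "?I *v b" "?N *v x"] by (simp add: field_simps)
  then have eq: "(\<integral>\<^sup>+x. ennreal (exp (b \<bullet> x - (x \<bullet> (M *v x)) / 2)) \<partial>lborel)
      = ennreal ?c * (\<integral>\<^sup>+x. ?G (?N *v x + - (?I *v b)) \<partial>lborel)"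
    by (simp only: exp_add ennreal_mult exp_ge_zero) (simp add: nn_integral_cmult)
  let ?d = "\<bar>det ?N\<bar>"
  have dN: "?d > 0" using invertible_msqrt[OF M] by (simp add: invertible_det_nz)
  have dM: "det M powr (-1/2) = 1 / ?d"
  proof -
    have "det M = ?d\<^sup>2" using msqrt_square[OF M] by (metis det_mul power2_abs power2_eq_square)
    then show ?thesis using dN by (simp add: powr_minus_divide powr_half_sqrt)
  qed
  have "ennreal ((2 * pi) powr (real CARD('n) / 2)) = (\<integral>\<^sup>+x. ?G (x + - (?I *v b)) \<partial>lborel)"
    by (subst nn_integral_lborel_shift) (simp_all only: nn_integral_std_gaussian, measurable)
  also have "\<dots> = ennreal ?d * (\<integral>\<^sup>+x. ?G (?N *v x + - (?I *v b)) \<partial>lborel)"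
    by (rule nn_integral_lborel_linear[OF invertible_msqrt[OF M]]) measurable
  finally have "ennreal (1 / ?d) * ennreal ((2 * pi) powr (real CARD('n) / 2))
      = ennreal (1 / ?d) * ennreal ?d * (\<integral>\<^sup>+x. ?G (?N *v x + - (?I *v b)) \<partial>lborel)"
    by (simp add: mult.assoc)
  also have "ennreal (1 / ?d) * ennreal ?d = 1" using dN by (simp flip: ennreal_mult)
  finally have "(\<integral>\<^sup>+x. ?G (?N *v x + - (?I *v b)) \<partial>lborel)
      = ennreal (1 / ?d * (2 * pi) powr (real CARD('n) / 2))"
    by (subst ennreal_mult) simp_all
  then show ?thesis unfolding eq dM by (simp add: ennreal_mult[symmetric] mult_ac)
qed

section \<open>Kronecker products and the statistics S and T\<close>

lemma sum_UNIV_prod: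
  "(\<Sum>p\<in>(UNIV :: ('a::finite \<times> 'b::finite) set). f p) = (\<Sum>i\<in>UNIV. \<Sum>j\<in>UNIV. f (i, j))"
  by (simp add: sum.cartesian_product)

lemma kronc_mult_vec: "kronc a (mat 1) *v y = kronv a y"
proof -
  have "(\<Sum>j\<in>UNIV. a $ fst p * mat 1 $ snd p $ j * y $ j) = a $ fst p * y $ snd p" for p
  proof -
    have "(\<Sum>j\<in>UNIV. a $ fst p * mat 1 $ snd p $ j * y $ j)
        = (\<Sum>j\<in>UNIV. if j = snd p then a $ fst p * y $ j else 0)"
      by (rule sum.cong) (auto simp: mat_def)
    then show ?thesis by simp
  qed
  then show ?thesis by (simp add: vec_eq_iff kronc_def kronv_def matrix_vector_mult_def)
qed

lemma kron_mult_kronv: "kron A B *v kronv a b = kronv (A *v a) (B *v b)"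
  by (simp add: vec_eq_iff kron_def kronv_def matrix_vector_mult_def sum_UNIV_prod sum_product mult_ac)

lemma kron_mult_kron: "kron A B ** kron C D = kron (A ** C) (B ** D)"
  by (simp add: vec_eq_iff kron_def matrix_matrix_mult_def sum_UNIV_prod sum_product mult_ac)

lemma transpose_kron: "transpose (kron A B) = kron (transpose A) (transpose B)"
  by (simp add: vec_eq_iff kron_def transpose_def)

lemma kron_mat_1: "kron (mat 1) (mat 1) = mat 1"
  by (auto simp: vec_eq_iff kron_def mat_def prod_eq_iff)

lemma invertible_kron:
  fixes A :: "real^'m^'m" and B :: "real^'k^'k"
  assumes "invertible A" "invertible B"
  shows "invertible (kron A B)" "matrix_inv (kron A B) = kron (matrix_inv A) (matrix_inv B)"
proof -
  have "kron A B ** kron (matrix_inv A) (matrix_inv B) = mat 1"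
    by (simp add: kron_mult_kron matrix_inv_mult assms kron_mat_1)
  then show "invertible (kron A B)" "matrix_inv (kron A B) = kron (matrix_inv A) (matrix_inv B)"
    using invertible_right_inverse matrix_inv_unique by blast+
qed

lemma vecm_sandwich: "vecm (g1 ** R ** transpose g2) = kron g2 g1 *v vecm R"
proof -
  have "(\<Sum>i\<in>UNIV. (\<Sum>j\<in>UNIV. g1 $ snd p $ j * R $ j $ i) * g2 $ fst p $ i)
      = (\<Sum>i\<in>UNIV. \<Sum>j\<in>UNIV. g2 $ fst p $ i * g1 $ snd p $ j * R $ j $ i)" for p
    by (simp add: sum_distrib_left sum_distrib_right mult_ac)
  then show ?thesis
    by (simp add: vec_eq_iff vecm_def kron_def matrix_vector_mult_def matrix_matrix_mult_def
        sum_UNIV_prod transpose_def)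
qed

lemma kronv_scaleR [simp]: "kronv (c *\<^sub>R a) b = c *\<^sub>R kronv a b" "kronv a (c *\<^sub>R b) = c *\<^sub>R kronv a b"
  by (simp_all add: vec_eq_iff kronv_def)

lemma kronv_add_right: "kronv a (x + y) = kronv a x + kronv a y"
  by (simp add: vec_eq_iff kronv_def algebra_simps)

lemma kronv_add_left: "kronv (a + b) x = kronv a x + kronv b x"
  by (simp add: vec_eq_iff kronv_def algebra_simps)

lemma inner_kronv: "kronv a x \<bullet> kronv b y = (a \<bullet> b) * (x \<bullet> y)"
  by (simp add: inner_vec_def kronv_def sum_UNIV_prod sum_product mult_ac)

lemma linear_kronv: "linear (kronv a)"
  by (rule linearI) (simp_all add: kronv_add_right)

lemma transpose_kronc_kronv:
  fixes y :: "real^'k"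
  shows "transpose (kronc a (mat 1 :: real^'k^'k)) *v kronv b y = (a \<bullet> b) *\<^sub>R y"
proof -
  have "x \<bullet> (transpose (kronc a (mat 1 :: real^'k^'k)) *v kronv b y) = x \<bullet> ((a \<bullet> b) *\<^sub>R y)" for x
    using inner_matrix_vector[of "kronv b y" "kronc a (mat 1)" x]
    by (simp add: kronc_mult_vec inner_kronv inner_commute)
  then show ?thesis by (meson vector_eq_ldot)
qed

lemma inner_transpose_kronc:
  "x \<bullet> (transpose (kronc a (mat 1)) *v z) = kronv a x \<bullet> z"
  using inner_matrix_vector[of z "kronc a (mat 1)" x]
  by (simp add: kronc_mult_vec inner_commute)

lemma unit_inner [simp]:
  "e1 \<bullet> e1 = 1" "e1 \<bullet> e2 = 0" "e2 \<bullet> e1 = 0" "e2 \<bullet> e2 = 1" "e1 \<bullet> aD d = d" "e2 \<bullet> aD d = 1"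
  by (simp_all add: e1_def e2_def aD_def inner_vec_def sum_2 vector_2)

lemma aD_split: "aD d = d *\<^sub>R e1 + e2"
  by (simp add: aD_def e1_def e2_def vec_eq_iff forall_2 vector_2)

lemma aD_0: "aD 0 = e2" by (simp add: aD_split)

lemma block_decomposition:
  fixes x :: "real^(2 \<times> 'k::finite)"
  shows "x = kronv e1 (transpose (kronc e1 (mat 1)) *v x) + kronv e2 (transpose (kronc e2 (mat 1)) *v x)"
proof -
  have "(transpose (kronc a (mat 1)) *v x) $ i = a $ 1 * x $ (1, i) + a $ 2 * x $ (2, i)"
    for i :: 'k and a :: "real^2"
  proof -
    have "(\<Sum>j\<in>UNIV. a $ l * mat 1 $ j $ i * x $ (l, j)) = a $ l * x $ (l, i)" for l
    proof -
      have "(\<Sum>j\<in>UNIV. a $ l * mat 1 $ j $ i * x $ (l, j))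
          = (\<Sum>j\<in>UNIV. if j = i then a $ l * x $ (l, j) else 0)"
        by (rule sum.cong) (auto simp: mat_def)
      then show ?thesis by simp
    qed
    then show ?thesis
      by (simp add: matrix_vector_mult_def transpose_def kronc_def sum_UNIV_prod sum_2)
  qed
  then show ?thesis
    by (simp add: vec_eq_iff kronv_def split_paired_all forall_2 e1_def e2_def vector_2)
qed

lemma kronv_eq_0_iff: "kronv a y = 0 \<longleftrightarrow> a = 0 \<or> y = 0"
proof -
  have "kronv a y = 0 \<longleftrightarrow> (a \<bullet> a) * (y \<bullet> y) = 0"
    unfolding inner_kronv[symmetric] by simp
  then show ?thesis by simp
qed

lemma e_nonzero: "e1 \<noteq> 0" "e2 \<noteq> 0" "aD d \<noteq> 0"
  using unit_inner by (metis inner_zero_right zero_neq_one)+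

section \<open>The linear bijection between the data and the pair (S, T)\<close>

definition unvec :: "real^(2 \<times> 'k) \<Rightarrow> real^2^'k" where
  "unvec x = (\<chi> i j. x $ (j, i))"

lemma vecm_unvec [simp]: "vecm (unvec x) = x" and unvec_vecm [simp]: "unvec (vecm R) = R"
  by (simp_all add: vec_eq_iff vecm_def unvec_def)

lemma linear_unvec: "linear unvec"
  by (rule linearI) (simp_all add: vec_eq_iff unvec_def)

text \<open>The covariance matrix of the first column of R, which standardises S.\<close>

definition Pm :: "real^(2\<times>'k)^(2\<times>'k) \<Rightarrow> real^'k^'k" where
  "Pm \<Sigma> = transpose (kronc e1 (mat 1)) ** \<Sigma> ** kronc e1 (mat 1)"

text \<open>The second diagonal block of the precision matrix, that is, the inverse of the
  conditional covariance of the second column of R given the first. It standardises T.\<close>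

definition Nm :: "real^(2\<times>'k)^(2\<times>'k) \<Rightarrow> real^'k^'k" where
  "Nm \<Sigma> = transpose (kronc e2 (mat 1)) ** matrix_inv \<Sigma> ** kronc e2 (mat 1)"

lemma pd_kronc_congruence:
  assumes "pd \<Sigma>" "a \<noteq> 0"
  shows "pd (transpose (kronc a (mat 1)) ** \<Sigma> ** kronc a (mat 1))"
  by (rule pd_congruence[OF assms(1)]) (simp add: kronc_mult_vec kronv_eq_0_iff assms(2))

lemma pd_Pm: "pd \<Sigma> \<Longrightarrow> pd (Pm \<Sigma>)" and pd_Nm: "pd \<Sigma> \<Longrightarrow> pd (Nm \<Sigma>)"
  by (simp_all add: Pm_def Nm_def pd_kronc_congruence e_nonzero pd_matrix_inv)

lemma Sst_eq: "Sst R \<Sigma> = misqrt (Pm \<Sigma>) *v (transpose (kronc e1 (mat 1)) *v vecm R)"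
  by (simp add: Sst_def Pm_def Let_def)

lemma Tst_eq: "Tst R \<Sigma> = misqrt (Nm \<Sigma>) *v (transpose (kronc e2 (mat 1)) *v (matrix_inv \<Sigma> *v vecm R))"
  by (simp add: Tst_def Nm_def Let_def)

lemma Pm_mult: "Pm \<Sigma> *v y = transpose (kronc e1 (mat 1)) *v (\<Sigma> *v kronv e1 y)"
  by (simp add: Pm_def flip: matrix_vector_mul_assoc kronc_mult_vec)

lemma Nm_mult: "Nm \<Sigma> *v y = transpose (kronc e2 (mat 1)) *v (matrix_inv \<Sigma> *v kronv e2 y)"
  by (simp add: Nm_def flip: matrix_vector_mul_assoc kronc_mult_vec)

text \<open>The inverse of vec(R) \<mapsto> (S, T). The first summand does not affect T, since the
  inverse of \<Sigma> maps it to a vector with zero second block; the second summand has zero first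
  block and so does not affect S.\<close>

definition rvec :: "real^'k \<Rightarrow> real^'k \<Rightarrow> real^(2\<times>'k)^(2\<times>'k) \<Rightarrow> real^(2\<times>'k)" where
  "rvec s t \<Sigma> = \<Sigma> *v kronv e1 (misqrt (Pm \<Sigma>) *v s) + kronv e2 (misqrt (Nm \<Sigma>) *v t)"

lemma misqrt_sandwich_vec: "pd A \<Longrightarrow> misqrt A *v (A *v (misqrt A *v x)) = x"
  by (simp add: matrix_vector_mul_assoc matrix_mul_assoc misqrt_sandwich)

lemma Sst_rvec:
  assumes "pd \<Sigma>" shows "Sst (unvec (rvec s t \<Sigma>)) \<Sigma> = s"
  by (simp add: Sst_eq rvec_def matrix_vector_right_distrib transpose_kronc_kronv
      misqrt_sandwich_vec[OF pd_Pm[OF assms]] flip: Pm_mult)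

lemma Tst_rvec:
  assumes "pd \<Sigma>" shows "Tst (unvec (rvec s t \<Sigma>)) \<Sigma> = t"
  by (simp add: Tst_eq rvec_def matrix_vector_right_distrib transpose_kronc_kronv
      matrix_inv_mult_vec[OF pd_invertible[OF assms]] misqrt_sandwich_vec[OF pd_Nm[OF assms]] flip: Nm_mult)

lemma misqrt_injective:
  assumes "pd A" "misqrt A *v x = misqrt A *v y" shows "x = y"
  by (metis assms matrix_vector_mul_assoc matrix_vector_mul_lid misqrt_msqrt(2))

text \<open>Let d be the difference of the two sides. Equal S forces d to have zero first block, and
  equal T makes the second block of its image under the inverse of \<Sigma> zero. The two are
  therefore orthogonal, and positive definiteness gives d = 0.\<close>

lemma vecm_eq_rvec:
  assumes "pd \<Sigma>"
  shows "vecm R = rvec (Sst R \<Sigma>) (Tst R \<Sigma>) \<Sigma>"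
proof -
  let ?r' = "rvec (Sst R \<Sigma>) (Tst R \<Sigma>) \<Sigma>" and ?Si = "matrix_inv \<Sigma>"
  define d where "d = vecm R - ?r'"
  have 1: "transpose (kronc e1 (mat 1)) *v d = 0"
    using misqrt_injective[OF pd_Pm[OF assms] Sst_rvec[OF assms, of "Sst R \<Sigma>" "Tst R \<Sigma>", unfolded Sst_eq[of _ \<Sigma>]]]
    by (simp add: d_def matrix_vector_mult_diff_distrib Sst_eq)
  have 2: "transpose (kronc e2 (mat 1)) *v (?Si *v d) = 0"
    using misqrt_injective[OF pd_Nm[OF assms] Tst_rvec[OF assms, of "Sst R \<Sigma>" "Tst R \<Sigma>", unfolded Tst_eq[of _ \<Sigma>]]]
    by (simp add: d_def matrix_vector_mult_diff_distrib Tst_eq)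
  have "d = kronv e2 (transpose (kronc e2 (mat 1)) *v d)"
    using block_decomposition[of d] 1 by (simp add: linear_0[OF linear_kronv])
  then have "d \<bullet> (?Si *v d) = 0"
    by (metis 2 inner_transpose_kronc inner_zero_right)
  then have "d = 0" using pdD(2)[OF pd_matrix_inv[OF assms], of d] by force
  then show ?thesis by (simp add: d_def)
qed

text \<open>\<open>r_of\<close> is a definite description; the explicit inverse supplies both
  existence and uniqueness.\<close>

lemma r_of_eq:
  assumes "pd \<Sigma>"
  shows "r_of s t \<Sigma> = unvec (rvec s t \<Sigma>)"
  unfolding r_of_def
proof (rule the_equality)
  show "Sst (unvec (rvec s t \<Sigma>)) \<Sigma> = s \<and> Tst (unvec (rvec s t \<Sigma>)) \<Sigma> = t"
    by (simp add: Sst_rvec Tst_rvec assms)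
  show "R = unvec (rvec s t \<Sigma>)" if "Sst R \<Sigma> = s \<and> Tst R \<Sigma> = t" for R
    using vecm_eq_rvec[OF assms, of R] that by (metis unvec_vecm)
qed

lemma r_of_Sst_Tst: "pd \<Sigma> \<Longrightarrow> r_of (Sst R \<Sigma>) (Tst R \<Sigma>) \<Sigma> = R"
  by (metis r_of_eq unvec_vecm vecm_eq_rvec)

lemma Sst_r_of: "pd \<Sigma> \<Longrightarrow> Sst (r_of s t \<Sigma>) \<Sigma> = s" and Tst_r_of: "pd \<Sigma> \<Longrightarrow> Tst (r_of s t \<Sigma>) \<Sigma> = t"
  by (simp_all add: r_of_eq Sst_rvec Tst_rvec)

lemma inner_mult_inv:
  assumes "pd \<Sigma>" shows "(\<Sigma> *v x) \<bullet> (matrix_inv \<Sigma> *v y) = x \<bullet> y"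
  using inner_matrix_vector[of "matrix_inv \<Sigma> *v y" \<Sigma> x]
  by (simp add: pdD(1)[OF assms] matrix_inv_mult_vec[OF pd_invertible[OF assms]] inner_commute)

text \<open>Isolates the dependence on s: it is linear, with coefficient proportional to d. This is
  why the log likelihood at fixed t is affine in s.\<close>

lemma inner_rvec:
  assumes "pd \<Sigma>"
  shows "rvec s t \<Sigma> \<bullet> (matrix_inv \<Sigma> *v kronv (aD d) m)
    = d * ((misqrt (Pm \<Sigma>) *v s) \<bullet> m) + kronv e2 (misqrt (Nm \<Sigma>) *v t) \<bullet> (matrix_inv \<Sigma> *v kronv (aD d) m)"
  by (simp add: rvec_def inner_add_left inner_mult_inv[OF assms] inner_kronv)

lemma inner_misqrt_sandwich:
  assumes "pd A"
  shows "(misqrt A *v x) \<bullet> (A *v (misqrt A *v x)) = x \<bullet> x"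
  using inner_matrix_vector[of "A *v (misqrt A *v x)" "misqrt A" x]
  by (simp add: pdD(1)[OF pd_misqrt[OF assms]] misqrt_sandwich_vec[OF assms] inner_commute)

text \<open>The two summands of \<open>rvec\<close> are orthogonal in the form given by the inverse
  of \<Sigma>, and their lengths in that form are those of S and T.\<close>

lemma quadratic_form_statistics:
  assumes "pd \<Sigma>"
  shows "vecm R \<bullet> (matrix_inv \<Sigma> *v vecm R) = Sst R \<Sigma> \<bullet> Sst R \<Sigma> + Tst R \<Sigma> \<bullet> Tst R \<Sigma>"
proof -
  let ?x = "kronv e1 (misqrt (Pm \<Sigma>) *v Sst R \<Sigma>)" and ?y = "kronv e2 (misqrt (Nm \<Sigma>) *v Tst R \<Sigma>)"
  note inv = matrix_inv_mult_vec[OF pd_invertible[OF assms]]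
  have "vecm R = \<Sigma> *v ?x + ?y" using vecm_eq_rvec[OF assms, of R] by (simp add: rvec_def)
  then have "vecm R \<bullet> (matrix_inv \<Sigma> *v vecm R)
      = ?x \<bullet> (\<Sigma> *v ?x) + (\<Sigma> *v ?x) \<bullet> (matrix_inv \<Sigma> *v ?y) + ?y \<bullet> ?x + ?y \<bullet> (matrix_inv \<Sigma> *v ?y)"
    by (simp add: matrix_vector_right_distrib inner_add_left inner_add_right inv inner_commute)
  moreover have "(\<Sigma> *v ?x) \<bullet> (matrix_inv \<Sigma> *v ?y) = 0" "?y \<bullet> ?x = 0"
    by (simp_all add: inner_mult_inv[OF assms] inner_kronv)
  moreover have "?x \<bullet> (\<Sigma> *v ?x) = Sst R \<Sigma> \<bullet> Sst R \<Sigma>"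
    by (simp add: inner_misqrt_sandwich[OF pd_Pm[OF assms]] flip: inner_transpose_kronc Pm_mult)
  moreover have "?y \<bullet> (matrix_inv \<Sigma> *v ?y) = Tst R \<Sigma> \<bullet> Tst R \<Sigma>"
    by (simp add: inner_misqrt_sandwich[OF pd_Nm[OF assms]] flip: inner_transpose_kronc Nm_mult)
  ultimately show ?thesis by simp
qed

section \<open>Level sets and quantiles\<close>

text \<open>The integral is a strictly convex function of s, strictness coming from
  \<open>nondeg\<close>. An interior point of a sublevel set is the midpoint of a segment in it and
  so has value strictly below c; hence the level set lies in the frontier of a convex set, which is
  negligible.\<close>

lemma negligible_level_set_integral_exp:
  fixes \<phi> :: "'a::euclidean_space \<Rightarrow> 'p \<Rightarrow> real"
  assumes int: "\<And>s. integrable M (\<lambda>p. exp (\<phi> s p))"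
    and aff: "\<And>s s' u p. \<phi> ((1 - u) *\<^sub>R s + u *\<^sub>R s') p = (1 - u) * \<phi> s p + u * \<phi> s' p"
    and nondeg: "\<And>s s'. s \<noteq> s' \<Longrightarrow> \<not> (AE p in M. \<phi> s p = \<phi> s' p)"
  shows "negligible {s. (\<integral>p. exp (\<phi> s p) \<partial>M) = c}"
proof -
  define g where "g s = (\<integral>p. exp (\<phi> s p) \<partial>M)" for s
  have "convex {s. g s \<le> c}"
    unfolding convex_alt
  proof (intro ballI allI impI, elim conjE, unfold mem_Collect_eq)
    fix x y and u :: real assume le: "g x \<le> c" "g y \<le> c" and u: "0 \<le> u" "u \<le> 1"
    have "g ((1 - u) *\<^sub>R x + u *\<^sub>R y) \<le> (\<integral>p. (1 - u) * exp (\<phi> x p) + u * exp (\<phi> y p) \<partial>M)"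
      unfolding g_def
    proof (rule integral_mono)
      show "exp (\<phi> ((1 - u) *\<^sub>R x + u *\<^sub>R y) p) \<le> (1 - u) * exp (\<phi> x p) + u * exp (\<phi> y p)" for p
        using convex_onD[OF exp_convex, of u "\<phi> x p" "\<phi> y p"] u by (simp add: aff)
    qed (auto intro!: int)
    also have "\<dots> = (1 - u) * g x + u * g y" by (simp add: g_def int)
    also have "\<dots> \<le> c" using convex_bound_le[of "g x" c "g y" "1 - u" u] le u by simp
    finally show "g ((1 - u) *\<^sub>R x + u *\<^sub>R y) \<le> c" .
  qed
  have mid: "g ((1/2) *\<^sub>R x + (1/2) *\<^sub>R y) < (g x + g y) / 2" if "x \<noteq> y" for x y
  proof -
    let ?D = "\<lambda>p. (exp (\<phi> x p) + exp (\<phi> y p)) / 2 - exp (\<phi> ((1/2) *\<^sub>R x + (1/2) *\<^sub>R y) p)"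
    \<comment> \<open>The convexity deficit at the midpoint is half a square, so its integral
      vanishes only if the two exponents agree almost everywhere.\<close>
    have D: "?D p = (exp (\<phi> x p / 2) - exp (\<phi> y p / 2))\<^sup>2 / 2" for p
    proof -
      have "exp (\<phi> ((1/2) *\<^sub>R x + (1/2) *\<^sub>R y) p) = exp (\<phi> x p / 2) * exp (\<phi> y p / 2)"
        using aff[of "1/2" x y p] by (simp flip: exp_add)
      moreover have "exp (\<phi> x p) = (exp (\<phi> x p / 2))\<^sup>2" "exp (\<phi> y p) = (exp (\<phi> y p / 2))\<^sup>2"
        using exp_double[of "\<phi> x p / 2"] exp_double[of "\<phi> y p / 2"] by simp_all
      ultimately show ?thesis by (simp add: power2_diff diff_divide_distrib add_divide_distrib)
    qed
    have "integrable M ?D" by (intro Bochner_Integration.integrable_diff integrable_divide Bochner_Integration.integrable_add int)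
    moreover have "(\<integral>p. ?D p \<partial>M) \<noteq> 0"
    proof
      assume "(\<integral>p. ?D p \<partial>M) = 0"
      then have "AE p in M. ?D p = 0"
        using integral_nonneg_eq_0_iff_AE[of M ?D] \<open>integrable M ?D\<close> by (simp only: D) simp
      then have "AE p in M. \<phi> x p = \<phi> y p" by (simp only: D) simp
      then show False using nondeg[OF that] by simp
    qed
    moreover have "(\<integral>p. ?D p \<partial>M) \<ge> 0" by (simp only: D) simp
    ultimately have "(\<integral>p. ?D p \<partial>M) > 0" by linarith
    then show ?thesis by (simp add: g_def int)
  qed
  have "{s. g s = c} \<subseteq> frontier {s. g s \<le> c}"
  proof
    fix s assume "s \<in> {s. g s = c}"
    then have gs: "g s = c" by simp
    have "s \<notin> interior {s. g s \<le> c}"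
    proof
      assume "s \<in> interior {s. g s \<le> c}"
      then obtain e where e: "e > 0" "cball s e \<subseteq> {s. g s \<le> c}" unfolding mem_interior_cball by blast
      obtain b :: 'a where b: "b \<in> Basis" using nonempty_Basis by blast
      have "g (s + e *\<^sub>R b) + g (s - e *\<^sub>R b) \<le> c + c"
        using e b by (intro add_mono) (auto simp: subset_iff dist_norm)
      moreover have "g s < (g (s + e *\<^sub>R b) + g (s - e *\<^sub>R b)) / 2"
      proof -
        have "s + e *\<^sub>R b \<noteq> s - e *\<^sub>R b"
          using e(1) b nonzero_Basis[OF b] by (auto simp: algebra_simps simp flip: scaleR_2)
        from mid[OF this] show ?thesis by (simp add: algebra_simps flip: scaleR_add_left)
      qed
      ultimately show False using gs by simp
    qed
    then show "s \<in> frontier {s. g s \<le> c}"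
      using gs closure_subset[of "{s. g s \<le> c}"] by (auto simp: frontier_def)
  qed
  then show ?thesis
    using negligible_convex_frontier[OF \<open>convex {s. g s \<le> c}\<close>] negligible_subset
    by (auto simp: g_def)
qed

section \<open>Quantiles of a real random variable\<close>

context prob_space
begin

lemma cdf_distr:
  assumes [measurable]: "X \<in> borel_measurable M"
  shows "cdf (distr M borel X) c = measure M {x \<in> space M. X x \<le> c}"
  by (simp add: cdf_def measure_distr vimage_def Int_def conj_commute)

text \<open>For p strictly between 0 and 1 the defining set is nonempty and bounded below, and right
  continuity of the distribution function makes its infimum attained. The resulting Galois
  connection replaces the infimum in later arguments.\<close>

lemma quantile_le_iff:
  assumes X[measurable]: "X \<in> borel_measurable M" and p: "0 < p" "p < 1"
  shows "quantile M X p \<le> c \<longleftrightarrow> p \<le> measure M {x \<in> space M. X x \<le> c}"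
proof -
  interpret D: real_distribution "distr M borel X" by simp
  let ?F = "cdf (distr M borel X)"
  let ?S = "{c. p \<le> ?F c}"
  have q: "quantile M X p = Inf ?S" by (simp add: quantile_def cdf_distr)
  have ne: "?S \<noteq> {}"
  proof -
    have "eventually (\<lambda>c. p < ?F c) at_top"
      using order_tendstoD(1)[OF D.cdf_lim_at_top_prob p(2)] .
    then show ?thesis by (auto dest!: eventually_happens less_imp_le)
  qed
  have bdd: "bdd_below ?S"
  proof -
    have "eventually (\<lambda>c. ?F c < p) at_bot"
      using order_tendstoD(2)[OF D.cdf_lim_at_bot p(1)] .
    then obtain b where "?F b < p" by (auto dest!: eventually_happens)
    then have "b \<le> c" if "c \<in> ?S" for c using D.cdf_nondecreasing[of c b] that by (cases "b \<le> c") auto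
    then show ?thesis by (auto simp: bdd_below_def)
  qed
  have "p \<le> ?F (Inf ?S)"
  proof (rule tendsto_lowerbound)
    show "(?F \<longlongrightarrow> ?F (Inf ?S)) (at_right (Inf ?S))"
      using D.cdf_is_right_cont by (simp add: continuous_within)
    show "\<forall>\<^sub>F c in at_right (Inf ?S). p \<le> ?F c"
      unfolding eventually_at_right_field
    proof (intro exI[of _ "Inf ?S + 1"] conjI allI impI)
      fix c assume "Inf ?S < c"
      then obtain d where "d \<in> ?S" "d < c" using cInf_lessD[OF ne] by blast
      then show "p \<le> ?F c" using D.cdf_nondecreasing[of d c] by simp
    qed simp
  qed simp
  then have "Inf ?S \<le> c \<Longrightarrow> p \<le> ?F c" using D.cdf_nondecreasing order_trans by blast
  then have "Inf ?S \<le> c \<longleftrightarrow> p \<le> ?F c" using cInf_lower[OF _ bdd, of c] by auto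
  then show ?thesis by (simp add: q cdf_distr)
qed

text \<open>Below the quantile the distribution function is under p. With no atom there it is also
  left continuous, so it cannot jump over p.\<close>

lemma measure_le_quantile:
  assumes X[measurable]: "X \<in> borel_measurable M" and p: "0 < p" "p < 1"
    and null: "measure M {x \<in> space M. X x = quantile M X p} = 0"
  shows "measure M {x \<in> space M. X x \<le> quantile M X p} = p"
proof -
  interpret D: real_distribution "distr M borel X" by simp
  let ?F = "cdf (distr M borel X)" and ?q = "quantile M X p"
  note le_iff = quantile_le_iff[OF X p, folded cdf_distr[OF X]]
  have "measure (distr M borel X) {?q} = 0"
    using null by (simp add: measure_distr vimage_def Int_def conj_commute)
  then have "(?F \<longlongrightarrow> ?F ?q) (at_left ?q)"
    using D.isCont_cdf[of ?q] by (simp add: isCont_def filterlim_at_split)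
  moreover have "\<forall>\<^sub>F c in at_left ?q. ?F c \<le> p"
    unfolding eventually_at_left_field 
  proof (intro exI[of _ "?q - 1"] conjI allI impI)
    show "?F c \<le> p" if "c < ?q" for c using le_iff[of c] that by linarith
  qed simp
  ultimately have "?F ?q \<le> p" using tendsto_upperbound by fastforce
  moreover have "p \<le> ?F ?q" using le_iff by blast
  ultimately show ?thesis by (simp add: cdf_distr)
qed

lemma quantile_scale:
  assumes X[measurable]: "X \<in> borel_measurable M" and p: "0 < p" "p < 1" and C: "C > 0"
  shows "quantile M (\<lambda>x. C * X x) p = C * quantile M X p"
proof -
  have "quantile M (\<lambda>x. C * X x) p \<le> c \<longleftrightarrow> C * quantile M X p \<le> c" for c
  proof -
    have "C * X x \<le> c \<longleftrightarrow> X x \<le> c / C" for x using C by (simp add: field_simps)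
    then have "quantile M (\<lambda>x. C * X x) p \<le> c \<longleftrightarrow> quantile M X p \<le> c / C"
      by (simp add: quantile_le_iff p)
    then show ?thesis using C by (simp add: field_simps)
  qed
  then show ?thesis by (meson order_antisym order_refl)
qed

lemma quantile_mono:
  assumes [measurable]: "X \<in> borel_measurable M" "Y \<in> borel_measurable M" and p: "0 < p" "p < 1"
    and le: "\<And>x. X x \<le> Y x"
  shows "quantile M X p \<le> quantile M Y p"
proof -
  have "p \<le> measure M {x \<in> space M. Y x \<le> quantile M Y p}"
    by (simp add: p flip: quantile_le_iff)
  also have "\<dots> \<le> measure M {x \<in> space M. X x \<le> quantile M Y p}"
    by (intro finite_measure_mono) (auto intro: order_trans[OF le])
  finally show ?thesis by (simp add: quantile_le_iff p)
qed

text \<open>The events X n \<le> c decrease to Y \<le> c, whose probability is below p; continuity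
  from above brings theirs below p as well.\<close>

lemma eventually_less_quantile:
  assumes [measurable]: "\<And>n. X n \<in> borel_measurable M" "Y \<in> borel_measurable M" and p: "0 < p" "p < 1"
    and inc: "\<And>x. incseq (\<lambda>n. X n x)" and lim: "\<And>x. (\<lambda>n. X n x) \<longlonglongrightarrow> Y x"
    and c: "c < quantile M Y p"
  shows "\<forall>\<^sub>F n in sequentially. c < quantile M (X n) p"
proof -
  let ?A = "\<lambda>n. {x \<in> space M. X n x \<le> c}"
  have "(\<Inter>n. ?A n) = {x \<in> space M. Y x \<le> c}"
  proof (intro set_eqI iffI)
    fix x assume "x \<in> (\<Inter>n. ?A n)"
    then show "x \<in> {x \<in> space M. Y x \<le> c}" using LIMSEQ_le_const2[OF lim[of x]] by auto
  next
    fix x assume "x \<in> {x \<in> space M. Y x \<le> c}"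
    then show "x \<in> (\<Inter>n. ?A n)" using incseq_le[OF inc lim] by (auto intro: order_trans)
  qed
  moreover have "(\<lambda>n. measure M (?A n)) \<longlonglongrightarrow> measure M (\<Inter>n. ?A n)"
    by (rule finite_Lim_measure_decseq) (use inc in \<open>auto simp: decseq_def incseq_def intro: order_trans\<close>)
  moreover have "measure M {x \<in> space M. Y x \<le> c} < p"
    using c quantile_le_iff[of Y p c] p by simp
  ultimately have "\<forall>\<^sub>F n in sequentially. measure M (?A n) < p"
    by (intro order_tendstoD(2)) auto
  then show ?thesis
  proof eventually_elim
    case (elim n)
    then show ?case using quantile_le_iff[of "X n" p c] p by simp
  qed
qed

end

section \<open>The integrated likelihood\<close>

lemma borel_measurable_kronv [measurable (raw)]:
  fixes h :: "_ \<Rightarrow> real^'k"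
  assumes "f \<in> borel_measurable M" "h \<in> borel_measurable M"
  shows "(\<lambda>x. kronv (aD (f x)) (h x)) \<in> borel_measurable M"
proof -
  have "(\<lambda>x. f x *\<^sub>R (kronc e1 (mat 1) *v h x) + kronc e2 (mat 1) *v h x) \<in> borel_measurable M"
    using assms by measurable
  then show ?thesis by (simp add: aD_split kronv_add_left kronc_mult_vec)
qed

text \<open>The likelihood of \<open>R\<close> at \<open>(\<Delta>, \<mu>)\<close>, relative to the density of \<open>S\<close> and up to a factor depending on \<open>\<Sigma>\<close> only.\<close>
definition lik :: "real^2^'k \<Rightarrow> real^(2\<times>'k)^(2\<times>'k) \<Rightarrow> real \<times> (real^'k) \<Rightarrow> real" where
  "lik R \<Sigma> p = (let v = kronv (aD (fst p)) (snd p) in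
     exp (vecm R \<bullet> (matrix_inv \<Sigma> *v v) - (v \<bullet> (matrix_inv \<Sigma> *v v)) / 2 - (Tst R \<Sigma> \<bullet> Tst R \<Sigma>) / 2))"

text \<open>The quotient of the normalising constants of \<open>fR\<close> and
  \<open>fS\<close>.\<close>

definition lik_const :: "real^(2\<times>'k::finite)^(2\<times>'k) \<Rightarrow> real" where
  "lik_const \<Sigma> = (2 * pi) powr (- real CARD('k)) * det \<Sigma> powr (-1/2) / (2 * pi) powr (- real CARD('k) / 2)"

lemma lik_pos: "lik R \<Sigma> p > 0" by (simp add: lik_def Let_def)

lemma borel_measurable_lik [measurable]: "lik R \<Sigma> \<in> borel_measurable borel"
  unfolding lik_def Let_def borel_prod[symmetric] by measurable

lemma lik_const_pos: "pd \<Sigma> \<Longrightarrow> lik_const \<Sigma> > 0"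
  using pd_det_pos[of \<Sigma>] by (simp add: lik_const_def)

text \<open>The quadratic form of R splits into S'S + T'T; dividing by \<open>fS\<close> removes
  S'S, and the remaining T'T is the one subtracted in the exponent of \<open>IL\<close>.\<close>

lemma fR_over_fS:
  assumes "pd \<Sigma>"
  shows "fR R d m \<Sigma> / fS (Sst R \<Sigma>) = lik_const \<Sigma> * lik R \<Sigma> (d, m)"
proof -
  let ?Si = "matrix_inv \<Sigma>" and ?v = "kronv (aD d) m" and ?r = "vecm R"
  have sym: "?v \<bullet> (?Si *v ?r) = ?r \<bullet> (?Si *v ?v)"
    using inner_matrix_vector[of ?v ?Si ?r] pdD(1)[OF pd_matrix_inv[OF assms]] by (simp add: inner_commute)
  have "- (1/2) * ((?r - ?v) \<bullet> (?Si *v (?r - ?v)))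
      = (?r \<bullet> (?Si *v ?v) - (?v \<bullet> (?Si *v ?v)) / 2 - (Tst R \<Sigma> \<bullet> Tst R \<Sigma>) / 2)
        + - (Sst R \<Sigma> \<bullet> Sst R \<Sigma>) / 2"
    using quadratic_form_statistics[OF assms, of R]
    by (simp add: matrix_vector_mult_diff_distrib inner_diff_left inner_diff_right sym field_simps)
  then have "exp (- (1/2) * ((?r - ?v) \<bullet> (?Si *v (?r - ?v)))) = lik R \<Sigma> (d, m) * exp (- (Sst R \<Sigma> \<bullet> Sst R \<Sigma>) / 2)"
    by (simp only: exp_add lik_def Let_def fst_conv snd_conv)
  then show ?thesis by (simp add: fR_def fS_def Let_def lik_const_def)
qed

lemma fw_over_fS:
  assumes "pd \<Sigma>"
  shows "fw w R \<Sigma> / fS (Sst R \<Sigma>) = lik_const \<Sigma> * integral\<^sup>L w (lik R \<Sigma>)"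
proof -
  have "fw w R \<Sigma> / fS (Sst R \<Sigma>) = (\<integral>p. fR R (fst p) (snd p) \<Sigma> / fS (Sst R \<Sigma>) \<partial>w)"
    by (simp add: fw_def)
  then show ?thesis by (simp add: fR_over_fS[OF assms])
qed

text \<open>The integrand of \<open>IL\<close> without the power of |\<Delta>|. It is kept apart
  because, up to a constant, it is the integral of \<open>lik\<close> over \<mu> alone.\<close>

definition IL_marginal :: "real^2^'k \<Rightarrow> real^(2\<times>'k)^(2\<times>'k) \<Rightarrow> real \<Rightarrow> real" where
  "IL_marginal R \<Sigma> \<Delta> = (let A = kronc (aD \<Delta>) (mat 1 :: real^'k^'k); r = vecm R; Sh = misqrt \<Sigma>
      in exp ((1/2) * (r \<bullet> ((Sh ** proj (Sh ** A) ** Sh) *v r) - Tst R \<Sigma> \<bullet> Tst R \<Sigma>))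
         * det (transpose A ** matrix_inv \<Sigma> ** A) powr (-1/2))"

lemma IL_eq_IL_marginal: "IL R \<Sigma> = (\<integral>d. IL_marginal R \<Sigma> d * \<bar>d\<bar> ^ (CARD('k) - 2) \<partial>lborel)"
  for R :: "real^2^'k"
  by (simp add: IL_def IL_marginal_def Let_def)

text \<open>A Gaussian integral with quadratic part M = A' \<Sigma>^(-1) A and linear part b = A'
  \<Sigma>^(-1) r. Completing the square leaves b' M^(-1) b / 2 in the exponent, and b' M^(-1) b is
  the projection term of \<open>IL\<close>.\<close>

lemma nn_integral_lik_eq_IL_marginal:
  fixes R :: "real^2^'k"
  assumes "pd \<Sigma>"
  shows "(\<integral>\<^sup>+m. ennreal (lik R \<Sigma> (d, m)) \<partial>lborel)
    = ennreal ((2 * pi) powr (real CARD('k) / 2) * IL_marginal R \<Sigma> d)"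
proof -
  let ?A = "kronc (aD d) (mat 1 :: real^'k^'k)" and ?Si = "matrix_inv \<Sigma>" and ?Sh = "misqrt \<Sigma>"
  let ?r = "vecm R" and ?T = "(Tst R \<Sigma> \<bullet> Tst R \<Sigma>) / 2"
  define M where "M = transpose ?A ** ?Si ** ?A"
  define b where "b = transpose ?A *v (?Si *v ?r)"
  have M: "pd M" unfolding M_def by (simp add: pd_kronc_congruence e_nonzero pd_matrix_inv assms)
  have sym: "transpose ?Si = ?Si" "transpose ?Sh = ?Sh"
    using assms by (simp_all add: pdD pd_matrix_inv pd_misqrt)
  have Av: "?A *v m = kronv (aD d) m" for m by (rule kronc_mult_vec)
  have bm: "b \<bullet> m = ?r \<bullet> (?Si *v kronv (aD d) m)" for m
    using inner_matrix_vector[of ?r ?Si "kronv (aD d) m"] inner_matrix_vector[of "?Si *v ?r" ?A m]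
    by (simp add: b_def sym Av)
  have mM: "m \<bullet> (M *v m) = kronv (aD d) m \<bullet> (?Si *v kronv (aD d) m)" for m
    using inner_matrix_vector[of "?Si *v kronv (aD d) m" ?A m]
    by (simp add: M_def Av inner_commute flip: matrix_vector_mul_assoc)
  have "lik R \<Sigma> (d, m) = exp (- ?T) * exp (b \<bullet> m - (m \<bullet> (M *v m)) / 2)" for m
    by (simp add: lik_def Let_def bm mM flip: exp_add)
  then have "(\<integral>\<^sup>+m. ennreal (lik R \<Sigma> (d, m)) \<partial>lborel)
      = ennreal (exp (- ?T)) * (\<integral>\<^sup>+m. ennreal (exp (b \<bullet> m - (m \<bullet> (M *v m)) / 2)) \<partial>lborel)"
    by (simp add: ennreal_mult nn_integral_cmult)
  also have "\<dots> = ennreal (exp (- ?T) * ((2 * pi) powr (real CARD('k) / 2) * det M powr (-1/2)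
        * exp (b \<bullet> (matrix_inv M *v b) / 2)))"
    by (simp add: nn_integral_gaussian[OF M] ennreal_mult)
  also have "exp (- ?T) * ((2 * pi) powr (real CARD('k) / 2) * det M powr (-1/2) * exp (b \<bullet> (matrix_inv M *v b) / 2))
      = (2 * pi) powr (real CARD('k) / 2) * IL_marginal R \<Sigma> d"
  proof -
    \<comment> \<open>\<open>?Sh\<close> is symmetric with square the inverse of \<Sigma>, so M is
      the Gram matrix inverted inside \<open>proj\<close>, and the outer factors \<open>?Sh\<close>
      complete the two inverses of \<Sigma>.\<close>
    have "transpose (?Sh ** ?A) ** (?Sh ** ?A) = transpose ?A ** (?Sh ** ?Sh) ** ?A"
      by (simp add: matrix_transpose_mul sym matrix_mul_assoc)
    then have MM: "transpose (?Sh ** ?A) ** (?Sh ** ?A) = M"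
      by (simp add: misqrt_square[OF assms] M_def)
    have "proj (?Sh ** ?A) = ?Sh ** ?A ** matrix_inv M ** transpose (?Sh ** ?A)"
      by (simp only: proj_def MM)
    then have "?Sh ** proj (?Sh ** ?A) ** ?Sh
        = (?Sh ** ?Sh) ** ?A ** matrix_inv M ** transpose ?A ** (?Sh ** ?Sh)"
      by (simp add: matrix_transpose_mul sym matrix_mul_assoc)
    then have "(?Sh ** proj (?Sh ** ?A) ** ?Sh) *v ?r = ?Si *v (?A *v (matrix_inv M *v b))"
      by (simp add: misqrt_square[OF assms] b_def matrix_vector_mul_assoc matrix_mul_assoc)
    then have "?r \<bullet> ((?Sh ** proj (?Sh ** ?A) ** ?Sh) *v ?r) = b \<bullet> (matrix_inv M *v b)"
      by (simp add: bm Av)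
    then have "IL_marginal R \<Sigma> d = exp (b \<bullet> (matrix_inv M *v b) / 2 + - ?T) * det M powr (-1/2)"
      by (simp add: IL_marginal_def Let_def M_def[symmetric] diff_divide_distrib)
    then show ?thesis by (simp only: exp_add) simp
  qed
  finally show ?thesis .
qed

text \<open>The restriction to S is placed in the density rather than in the space, so all weights
  live on the same sigma-algebra and can be compared through \<open>wgt UNIV\<close>.\<close>

definition wgt :: "(real \<times> (real^'k)) set \<Rightarrow> (real \<times> (real^'k)) measure" where
  "wgt S = density lborel (\<lambda>p. ennreal (indicator S p * \<bar>fst p\<bar> ^ (CARD('k) - 2)))"

lemma sets_wgt [simp, measurable_cong]: "sets (wgt S) = sets borel" and space_wgt [simp]: "space (wgt S) = UNIV"
  by (simp_all add: wgt_def)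

lemma borel_measurable_fst_snd [measurable]:
  "fst \<in> borel_measurable (borel :: ('a::second_countable_topology \<times> 'b::second_countable_topology) measure)"
  "snd \<in> borel_measurable (borel :: ('a \<times> 'b) measure)"
  unfolding borel_prod[symmetric] by measurable

lemma nn_integral_wgt_UNIV:
  assumes [measurable]: "f \<in> borel_measurable borel"
  shows "(\<integral>\<^sup>+p. f p \<partial>wgt UNIV)
    = (\<integral>\<^sup>+d. ennreal (\<bar>d\<bar> ^ (CARD('k) - 2)) * (\<integral>\<^sup>+(m::real^'k). f (d, m) \<partial>lborel) \<partial>lborel)"
proof -
  have f[measurable]: "f \<in> borel_measurable (lborel \<Otimes>\<^sub>M lborel)" by (simp add: lborel_prod)
  have "(\<integral>\<^sup>+p. f p \<partial>wgt UNIV)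
      = (\<integral>\<^sup>+p. ennreal (\<bar>fst p\<bar> ^ (CARD('k) - 2)) * f p \<partial>(lborel \<Otimes>\<^sub>M lborel))"
    by (simp add: wgt_def nn_integral_density lborel_prod)
  also have "\<dots> = (\<integral>\<^sup>+d. (\<integral>\<^sup>+m. ennreal (\<bar>d\<bar> ^ (CARD('k) - 2)) * f (d, m) \<partial>lborel) \<partial>lborel)"
    by (subst lborel.nn_integral_fst[symmetric]) simp_all
  also have "\<dots> = (\<integral>\<^sup>+d. ennreal (\<bar>d\<bar> ^ (CARD('k) - 2)) * (\<integral>\<^sup>+m. f (d, m) \<partial>lborel) \<partial>lborel)"
    by (intro nn_integral_cong nn_integral_cmult) measurable
  finally show ?thesis .
qed

lemma inverse_1_plus_square_finite: "(\<integral>\<^sup>+(d::real). ennreal (inverse (1 + d\<^sup>2)) \<partial>lborel) < \<infinity>"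
proof -
  have "integrable lborel (\<lambda>x::real. inverse (1 + x\<^sup>2))"
    using integrable_inverse_1_plus_square by (simp add: set_integrable_def)
  then show ?thesis by (simp add: integrable_iff_bounded)
qed

text \<open>Half of the quadratic term absorbs the linear one by Young's inequality, and the other
  half gives the decay, because |a_\<Delta> \<otimes> \<mu>|^2 = (1 + \<Delta>^2) |\<mu>|^2. The
  term T'T only helps.\<close>

lemma lik_bound:
  fixes R :: "real^2^'k"
  assumes "pd \<Sigma>"
  obtains K l where "K > 0" "l > 0" "\<And>d m. lik R \<Sigma> (d, m) \<le> K * exp (- (l * (1 + d\<^sup>2) * (m \<bullet> m)) / 2)"
proof -
  let ?Si = "matrix_inv \<Sigma>"
  obtain l where l: "l > 0" "\<And>x. l * (x \<bullet> x) \<le> x \<bullet> (?Si *v x)"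
    using pd_lower_bound[OF pd_matrix_inv[OF assms]] by blast
  let ?w = "?Si *v vecm R"
  have main: "vecm R \<bullet> (?Si *v v) - (v \<bullet> (?Si *v v)) / 2 \<le> (?w \<bullet> ?w) / l - l * (v \<bullet> v) / 4" for v
  proof -
    have "vecm R \<bullet> (?Si *v v) = ?w \<bullet> v"
      using inner_matrix_vector[of "vecm R" ?Si v] pdD(1)[OF pd_matrix_inv[OF assms]] by simp
    moreover have "?w \<bullet> v \<le> (?w \<bullet> ?w) / l + l * (v \<bullet> v) / 4"
    proof -
      \<comment> \<open>Young's inequality with the scaling that leaves exactly l (v . v) /
        4.\<close>
      have "0 \<le> (2 *\<^sub>R ?w - l *\<^sub>R v) \<bullet> (2 *\<^sub>R ?w - l *\<^sub>R v)" by simp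
      also have "\<dots> = 4 * (?w \<bullet> ?w) - 4 * l * (?w \<bullet> v) + l\<^sup>2 * (v \<bullet> v)"
        by (simp add: inner_diff_left inner_diff_right inner_commute[of v ?w] power2_eq_square algebra_simps)
      finally show ?thesis using l(1) by (simp add: field_simps power2_eq_square)
    qed
    ultimately show ?thesis using l(2)[of v] by linarith
  qed
  have "lik R \<Sigma> (d, m) \<le> exp ((?w \<bullet> ?w) / l) * exp (- (l / 2 * (1 + d\<^sup>2) * (m \<bullet> m)) / 2)" for d m
  proof -
    have v: "kronv (aD d) m \<bullet> kronv (aD d) m = (1 + d\<^sup>2) * (m \<bullet> m)"
      unfolding inner_kronv by (simp add: aD_def inner_vec_def sum_2 vector_2 power2_eq_square)
    have "vecm R \<bullet> (?Si *v kronv (aD d) m) - (kronv (aD d) m \<bullet> (?Si *v kronv (aD d) m)) / 2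
        - (Tst R \<Sigma> \<bullet> Tst R \<Sigma>) / 2 \<le> (?w \<bullet> ?w) / l - l * ((1 + d\<^sup>2) * (m \<bullet> m)) / 4"
      using main[of "kronv (aD d) m"] inner_ge_zero[of "Tst R \<Sigma>"] unfolding v by linarith
    then show ?thesis by (simp add: lik_def Let_def mult.assoc flip: exp_add)
  qed
  then show thesis using that[of "exp ((?w \<bullet> ?w) / l)" "l / 2"] l(1) by simp
qed

lemma pd_scaled_mat: "c > 0 \<Longrightarrow> pd (c *\<^sub>R mat 1)"
  by (simp add: pd_def transpose_scalar flip: scaleR_matrix_vector_assoc)

text \<open>Integrating the bound over \<mu> produces (1 + d^2)^(-k/2), and |d|^(k-2) \<le> (1 +
  d^2)^((k-2)/2) leaves the integrable 1 / (1 + d^2).\<close>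

lemma nn_integral_lik_finite:
  fixes R :: "real^2^'k"
  assumes "pd \<Sigma>" and k: "CARD('k) \<ge> 2"
  shows "(\<integral>\<^sup>+p. ennreal (lik R \<Sigma> p) \<partial>wgt UNIV) < \<infinity>"
proof -
  obtain K l where K: "K > 0" "l > 0"
    "\<And>d m. lik R \<Sigma> (d, m) \<le> K * exp (- (l * (1 + d\<^sup>2) * (m \<bullet> m)) / 2)"
    using lik_bound[OF assms(1)] by blast
  let ?k = "CARD('k)" and ?g = "(2 * pi) powr (real CARD('k) / 2)"
  let ?C = "K * ?g * l powr (- real ?k / 2)"
  have inner: "ennreal (\<bar>d\<bar> ^ (?k - 2)) * (\<integral>\<^sup>+m. ennreal (lik R \<Sigma> (d, m)) \<partial>lborel)
      \<le> ennreal ?C * ennreal (inverse (1 + d\<^sup>2))" for d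
  proof -
    let ?q = "1 + d\<^sup>2"
    have q: "?q > 0" by (simp add: add_pos_nonneg)
    let ?M = "(l * ?q) *\<^sub>R mat 1 :: real^'k^'k"
    have M: "pd ?M" using K(2) q by (intro pd_scaled_mat) simp
    have "det ?M = (l * ?q) ^ ?k" by (simp add: det_diagonal mat_def)
    then have detM: "det ?M powr (-1/2) = l powr (- real ?k / 2) * ?q powr (- real ?k / 2)"
    proof -
      have "det ?M powr (-1/2) = (l * ?q) powr (real ?k * (-1/2))"
        using K(2) q by (simp only: \<open>det ?M = _\<close> powr_powr mult_pos_pos flip: powr_realpow)
      also have "real ?k * (-1/2) = - real ?k / 2" by simp
      finally show ?thesis using K(2) q by (simp add: powr_mult)
    qed
    have Mm: "m \<bullet> (?M *v m) = l * ?q * (m \<bullet> m)" for m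
      by (simp flip: scaleR_matrix_vector_assoc)
    have "(\<integral>\<^sup>+m. ennreal (lik R \<Sigma> (d, m)) \<partial>lborel)
        \<le> (\<integral>\<^sup>+m. ennreal K * ennreal (exp (0 \<bullet> m - (m \<bullet> (?M *v m)) / 2)) \<partial>lborel)"
      using K(1) K(3)[of d] by (intro nn_integral_mono) (simp add: Mm flip: ennreal_mult)
    also have "\<dots> = ennreal K * ennreal (?g * det ?M powr (-1/2))"
      by (subst nn_integral_cmult) (simp_all only: nn_integral_gaussian[OF M], simp_all)
    also have "\<dots> = ennreal (?C * ?q powr (- real ?k / 2))"
      unfolding detM using K(1) by (simp add: mult_ac flip: ennreal_mult)
    finally have "ennreal (\<bar>d\<bar> ^ (?k - 2)) * (\<integral>\<^sup>+m. ennreal (lik R \<Sigma> (d, m)) \<partial>lborel)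
        \<le> ennreal (\<bar>d\<bar> ^ (?k - 2)) * ennreal (?C * ?q powr (- real ?k / 2))"
      by (rule mult_left_mono) simp
    also have "\<dots> \<le> ennreal (?C * inverse ?q)"
    proof -
      have "\<bar>d\<bar> ^ (?k - 2) \<le> (?q powr (1/2)) ^ (?k - 2)"
        by (intro power_mono) (simp_all add: powr_half_sqrt real_le_rsqrt)
      also have "\<dots> = ?q powr ((real ?k - 2) / 2)"
        using q k by (simp add: powr_powr of_nat_diff flip: powr_realpow)
      finally have "\<bar>d\<bar> ^ (?k - 2) * ?q powr (- real ?k / 2) \<le> ?q powr ((real ?k - 2) / 2) * ?q powr (- real ?k / 2)"
        by (rule mult_right_mono) simp
      also have "\<dots> = inverse ?q"
      proof -
        have e: "(real ?k - 2) / 2 + - real ?k / 2 = - 1" by (simp add: field_simps)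
        show ?thesis unfolding powr_add[symmetric] e using q by (simp add: powr_minus)
      qed
      finally have "?C * (\<bar>d\<bar> ^ (?k - 2) * ?q powr (- real ?k / 2)) \<le> ?C * inverse ?q"
        using K(1) by (intro mult_left_mono) simp_all
      then show ?thesis using K(1) by (simp add: ennreal_mult[symmetric] mult_ac)
    qed
    also have "\<dots> = ennreal ?C * ennreal (inverse ?q)" using K(1) q by (intro ennreal_mult) simp_all
    finally show ?thesis .
  qed
  have "(\<integral>\<^sup>+p. ennreal (lik R \<Sigma> p) \<partial>wgt UNIV) \<le> (\<integral>\<^sup>+d. ennreal ?C * ennreal (inverse (1 + d\<^sup>2)) \<partial>lborel)"
    using inner by (subst nn_integral_wgt_UNIV) (auto intro!: nn_integral_mono)
  also have "\<dots> = ennreal ?C * (\<integral>\<^sup>+d. ennreal (inverse (1 + d\<^sup>2)) \<partial>lborel)"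
    by (rule nn_integral_cmult) measurable
  also have "\<dots> < \<infinity>" using inverse_1_plus_square_finite by (simp add: ennreal_mult_less_top)
  finally show ?thesis .
qed

lemma integrable_lik:
  fixes R :: "real^2^'k"
  assumes "pd \<Sigma>" "CARD('k) \<ge> 2"
  shows "integrable (wgt UNIV) (lik R \<Sigma>)"
  using nn_integral_lik_finite[OF assms, of R] lik_pos[of R \<Sigma>]
  by (simp add: integrable_iff_bounded less_imp_le)

lemma IL_marginal_nonneg: "IL_marginal R \<Sigma> d \<ge> 0"
  by (simp add: IL_marginal_def Let_def)

text \<open>Measurability in \<Delta> is inherited from the partial integral of \<open>lik\<close>,
  which avoids treating the matrix inverse and determinant as functions of \<Delta>.\<close>

lemma borel_measurable_IL_marginal:
  fixes R :: "real^2^'k"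
  assumes "pd \<Sigma>"
  shows "IL_marginal R \<Sigma> \<in> borel_measurable borel"
proof -
  let ?g = "(2 * pi) powr (real CARD('k) / 2)"
  have eq: "?g * IL_marginal R \<Sigma> d = enn2real (\<integral>\<^sup>+m. ennreal (lik R \<Sigma> (d, m)) \<partial>lborel)" for d
    using IL_marginal_nonneg[of R \<Sigma> d] by (simp add: nn_integral_lik_eq_IL_marginal[OF assms])
  have "(\<lambda>x. lik R \<Sigma> (fst x, snd x)) \<in> borel_measurable (borel \<Otimes>\<^sub>M borel)"
    by (simp add: borel_prod)
  then have "(\<lambda>d. enn2real (\<integral>\<^sup>+m. ennreal (lik R \<Sigma> (d, m)) \<partial>lborel) / ?g) \<in> borel_measurable borel"
    by measurable
  then show ?thesis by (simp flip: eq)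
qed

lemma nn_integral_IL_marginal:
  fixes R :: "real^2^'k"
  assumes "pd \<Sigma>"
  shows "ennreal ((2 * pi) powr (real CARD('k) / 2)) * (\<integral>\<^sup>+d. ennreal (IL_marginal R \<Sigma> d * \<bar>d\<bar> ^ (CARD('k) - 2)) \<partial>lborel)
    = (\<integral>\<^sup>+p. ennreal (lik R \<Sigma> p) \<partial>wgt UNIV)"
proof -
  note [measurable] = borel_measurable_IL_marginal[OF assms, of R]
  show ?thesis
    by (simp add: nn_integral_wgt_UNIV nn_integral_lik_eq_IL_marginal[OF assms] IL_marginal_nonneg ennreal_mult mult_ac
        flip: nn_integral_cmult)
qed

lemma integrable_IL_marginal:
  fixes R :: "real^2^'k"
  assumes "pd \<Sigma>" "CARD('k) \<ge> 2"
  shows "integrable lborel (\<lambda>d. IL_marginal R \<Sigma> d * \<bar>d\<bar> ^ (CARD('k) - 2))"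
proof -
  note [measurable] = borel_measurable_IL_marginal[OF assms(1), of R]
  have "(\<integral>\<^sup>+d. ennreal (IL_marginal R \<Sigma> d * \<bar>d\<bar> ^ (CARD('k) - 2)) \<partial>lborel) < \<infinity>"
    using nn_integral_lik_finite[OF assms, of R] unfolding nn_integral_IL_marginal[OF assms(1), symmetric]
    by (auto simp: ennreal_mult_less_top)
  then show ?thesis by (simp add: integrable_iff_bounded IL_marginal_nonneg)
qed

text \<open>The constant is the one of the Gaussian integral over \<open>\<mu>\<close>.\<close>
lemma IL_eq_integral_lik:
  fixes R :: "real^2^'k"
  assumes "pd \<Sigma>" "CARD('k) \<ge> 2"
  shows "IL R \<Sigma> = (2 * pi) powr (- real CARD('k) / 2) * (\<integral>p. lik R \<Sigma> p \<partial>wgt UNIV)"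
proof -
  let ?g = "(2 * pi) powr (real CARD('k) / 2)" and ?f = "\<lambda>d. IL_marginal R \<Sigma> d * \<bar>d\<bar> ^ (CARD('k) - 2)"
  have "ennreal (?g * IL R \<Sigma>) = ennreal ?g * (\<integral>\<^sup>+d. ennreal (?f d) \<partial>lborel)"
    unfolding IL_eq_IL_marginal
    by (subst nn_integral_eq_integral[OF integrable_IL_marginal[OF assms]])
      (simp_all add: IL_marginal_nonneg ennreal_mult integral_nonneg)
  also have "\<dots> = ennreal (\<integral>p. lik R \<Sigma> p \<partial>wgt UNIV)"
    unfolding nn_integral_IL_marginal[OF assms(1)]
    using lik_pos[of R \<Sigma>] by (intro nn_integral_eq_integral integrable_lik assms) (simp add: less_imp_le)
  finally have "?g * IL R \<Sigma> = (\<integral>p. lik R \<Sigma> p \<partial>wgt UNIV)"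
    using lik_pos[of R \<Sigma>]
    by (subst (asm) ennreal_inj) (simp_all add: IL_eq_IL_marginal IL_marginal_nonneg less_imp_le)
  then show ?thesis by (simp add: powr_minus field_simps)
qed

section \<open>Approximation by similar tests\<close>

lemma space_stdnormal [simp]: "space stdnormal = UNIV" and sets_stdnormal [simp, measurable_cong]: "sets stdnormal = sets borel"
  by (simp_all add: stdnormal_def)

lemma borel_measurable_fS [measurable]: "fS \<in> borel_measurable borel"
  unfolding fS_def by measurable

lemma prob_space_stdnormal: "prob_space (stdnormal :: (real^'k) measure)"
proof
  have "ennreal (fS s) = ennreal ((2 * pi) powr (- real CARD('k) / 2)) * ennreal (exp (- (s \<bullet> s) / 2))" for s :: "real^'k"
    by (simp add: fS_def ennreal_mult)
  then have "emeasure (stdnormal :: (real^'k) measure) (space stdnormal)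
      = ennreal ((2 * pi) powr (- real CARD('k) / 2)) * ennreal ((2 * pi) powr (real CARD('k) / 2))"
    by (simp add: stdnormal_def emeasure_density nn_integral_cmult nn_integral_std_gaussian[simplified])
  then show "emeasure (stdnormal :: (real^'k) measure) (space stdnormal) = 1"
    by (simp add: powr_minus flip: ennreal_mult)
qed

lemma AE_lborel_notin_negligible:
  fixes A :: "'a::euclidean_space set"
  assumes "negligible A" shows "AE x in lborel. x \<notin> A"
proof -
  obtain N where "N \<in> null_sets lborel" "A \<subseteq> N"
    using assms by (auto simp: negligible_iff_null_sets null_sets_completion_iff2)
  then show ?thesis by (auto intro: AE_I'[of N])
qed

lemma measure_stdnormal_negligible:
  assumes "negligible A" "A \<in> sets borel"
  shows "measure stdnormal A = 0"
proof -
  have "emeasure stdnormal A = (\<integral>\<^sup>+x. ennreal (fS x) * indicator A x \<partial>lborel)"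
    using assms(2) by (simp add: stdnormal_def emeasure_density)
  also have "\<dots> = (\<integral>\<^sup>+(x::real^'a). 0 \<partial>lborel)"
    by (rule nn_integral_cong_AE) (use AE_lborel_notin_negligible[OF assms(1)] in \<open>auto simp: indicator_def\<close>)
  finally show ?thesis by (simp add: measure_def)
qed

text \<open>The radius is \<open>Suc n\<close> so that already \<open>wbox 0\<close> has interior,
  which the nondegeneracy of every level-set argument relies on.\<close>

definition wbox :: "nat \<Rightarrow> (real \<times> (real^'k)) set" where
  "wbox n = {p. \<bar>fst p\<bar> \<le> real (Suc n) \<and> norm (snd p) \<le> real (Suc n)}"

lemma wbox_eq: "wbox n = cball 0 (real (Suc n)) \<times> cball 0 (real (Suc n))"
  by (auto simp: wbox_def)

lemma sets_wbox [measurable]: "wbox n \<in> sets borel"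
  by (simp add: wbox_eq borel_closed closed_Times)

lemma finite_measure_wgt_wbox: "finite_measure (wgt (wbox n :: (real \<times> (real^'k)) set))"
proof
  let ?c = "real (Suc n) ^ (CARD('k) - 2)"
  have "emeasure (wgt (wbox n :: (real \<times> (real^'k)) set)) UNIV
      = (\<integral>\<^sup>+p. ennreal (indicator (wbox n) p * \<bar>fst p\<bar> ^ (CARD('k) - 2)) \<partial>(lborel :: (real \<times> (real^'k)) measure))"
    by (simp add: wgt_def emeasure_density)
  also have "\<dots> \<le> (\<integral>\<^sup>+p. ennreal ?c * indicator (wbox n) p \<partial>(lborel :: (real \<times> (real^'k)) measure))"
    by (intro nn_integral_mono) (auto simp: indicator_def wbox_def intro!: ennreal_leI power_mono)
  also have "\<dots> = ennreal ?c * emeasure lborel (wbox n :: (real \<times> (real^'k)) set)"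
    by (simp add: nn_integral_cmult_indicator)
  also have "\<dots> < \<infinity>"
    using emeasure_bounded_finite[of "wbox n :: (real \<times> (real^'k)) set"]
    by (simp add: wbox_eq bounded_Times ennreal_mult_less_top)
  finally show "emeasure (wgt (wbox n :: (real \<times> (real^'k)) set)) (space (wgt (wbox n))) \<noteq> \<infinity>" by simp
qed

lemma sigma_finite_wgt:
  assumes [measurable]: "S \<in> sets borel"
  shows "sigma_finite_measure (wgt S)"
  unfolding wgt_def by (subst sigma_finite_measure.sigma_finite_iff_density_finite[OF sigma_finite_lborel]) auto

text \<open>Moves the integrals over different boxes to the common measure \<open>wgt UNIV\<close>,
  where monotonicity and dominated convergence apply.\<close>

lemma
  fixes f :: "real \<times> (real^'k) \<Rightarrow> real"
  assumes [measurable]: "S \<in> sets borel" "f \<in> borel_measurable borel"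
  shows integral_wgt: "integral\<^sup>L (wgt S) f = (\<integral>p. indicator S p * f p \<partial>wgt UNIV)"
    and integrable_wgt: "integrable (wgt UNIV) f \<Longrightarrow> integrable (wgt S) f"
proof -
  have eq: "(indicator S p * \<bar>fst p\<bar> ^ (CARD('k) - 2)) * f p
      = (indicator UNIV p * \<bar>fst p\<bar> ^ (CARD('k) - 2)) * (indicator S p * f p)" for p :: "real \<times> (real^'k)"
    by simp
  show "integral\<^sup>L (wgt S) f = (\<integral>p. indicator S p * f p \<partial>wgt UNIV)"
    unfolding wgt_def by (subst (1 2) integral_density) (auto simp: mult_ac)
  assume "integrable (wgt UNIV) f"
  then have "integrable (wgt UNIV) (\<lambda>p. indicator S p * f p)"
    by (rule Bochner_Integration.integrable_bound) (auto simp: indicator_def)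
  then show "integrable (wgt S) f"
    unfolding wgt_def by (subst (asm) integrable_density, simp, simp, simp, subst integrable_density) (auto simp: mult_ac)
qed

lemma lik_r_of:
  fixes s :: "real^'k"
  assumes "pd \<Sigma>"
  shows "lik (r_of s t \<Sigma>) \<Sigma> p = exp (fst p * ((misqrt (Pm \<Sigma>) *v s) \<bullet> snd p)
    + (kronc e2 (mat 1) *v (misqrt (Nm \<Sigma>) *v t)) \<bullet> (matrix_inv \<Sigma> *v kronv (aD (fst p)) (snd p))
    - (kronv (aD (fst p)) (snd p) \<bullet> (matrix_inv \<Sigma> *v kronv (aD (fst p)) (snd p))) / 2 - (t \<bullet> t) / 2)"
  by (simp add: lik_def Let_def Tst_r_of assms r_of_eq inner_rvec kronc_mult_vec)
    (simp add: Tst_rvec assms)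

text \<open>The test statistic in the coordinates (s, t), without the constant factors that a test
  and its critical value share.\<close>

definition ilik :: "(real \<times> (real^'k)) set \<Rightarrow> real^(2\<times>'k)^(2\<times>'k) \<Rightarrow> real^'k \<Rightarrow> real^'k \<Rightarrow> real" where
  "ilik S \<Sigma> s t = (\<integral>p. lik (r_of s t \<Sigma>) \<Sigma> p \<partial>wgt S)"

text \<open>Joint measurability in s and t is intended, hence the two functions f and g; the weight
  is sigma-finite, so the parameter integral is measurable.\<close>

lemma borel_measurable_ilik [measurable (raw)]:
  fixes f :: "_ \<Rightarrow> real^'k"
  assumes \<Sigma>: "pd \<Sigma>" and S: "S \<in> sets borel" and [measurable]: "f \<in> borel_measurable M" "g \<in> borel_measurable M"
  shows "(\<lambda>x. ilik S \<Sigma> (f x) (g x)) \<in> borel_measurable M"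
proof -
  interpret sigma_finite_measure "wgt S :: (real \<times> (real^'k)) measure" by (rule sigma_finite_wgt[OF S])
  show ?thesis
    unfolding ilik_def lik_r_of[OF \<Sigma>] by measurable
qed

text \<open>The exponents at s and s' differ by \<Delta> (u . \<mu>) with u nonzero, and this is
  nonzero on an open set of positive weight inside \<open>wbox 0\<close>.\<close>

lemma negligible_level_set_ilik:
  fixes S :: "(real \<times> (real^'k)) set"
  assumes \<Sigma>: "pd \<Sigma>" and k: "CARD('k) \<ge> 2" and S[measurable]: "S \<in> sets borel" and box: "wbox 0 \<subseteq> S"
  shows "negligible {s. ilik S \<Sigma> s t = c}"
  unfolding ilik_def lik_r_of[OF \<Sigma>]
proof (rule negligible_level_set_integral_exp)
  fix s
  show "integrable (wgt S) (\<lambda>p. exp (fst p * ((misqrt (Pm \<Sigma>) *v s) \<bullet> snd p)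
    + (kronc e2 (mat 1) *v (misqrt (Nm \<Sigma>) *v t)) \<bullet> (matrix_inv \<Sigma> *v kronv (aD (fst p)) (snd p))
    - (kronv (aD (fst p)) (snd p) \<bullet> (matrix_inv \<Sigma> *v kronv (aD (fst p)) (snd p))) / 2 - (t \<bullet> t) / 2))"
    using integrable_wgt[OF S borel_measurable_lik integrable_lik[OF \<Sigma> k, of "r_of s t \<Sigma>"]]
    by (simp only: lik_r_of[OF \<Sigma>, abs_def])
next
  fix s s' :: "real^'k" assume "s \<noteq> s'"
  define u where "u = misqrt (Pm \<Sigma>) *v s - misqrt (Pm \<Sigma>) *v s'"
  have "u \<noteq> 0" using misqrt_injective[OF pd_Pm[OF \<Sigma>], of s s'] \<open>s \<noteq> s'\<close> by (auto simp: u_def)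
  \<comment> \<open>Excluding \<Delta> = 0 keeps both the exponent difference and the density of the
    weight away from zero on \<open>U\<close>.\<close>
  define U where "U = {p :: real \<times> (real^'k). fst p \<noteq> 0 \<and> \<bar>fst p\<bar> < 1 \<and> norm (snd p) < 1 \<and> u \<bullet> snd p \<noteq> 0}"
  have "open U"
    unfolding U_def by (intro open_Collect_conj open_Collect_neq open_Collect_less continuous_intros)
  moreover have "(1/2, (1 / (2 * norm u)) *\<^sub>R u) \<in> U" using \<open>u \<noteq> 0\<close> by (simp add: U_def)
  ultimately have "\<not> negligible U" using open_not_negligible by blast
  show "\<not> (AE p in wgt S. fst p * ((misqrt (Pm \<Sigma>) *v s) \<bullet> snd p)
    + (kronc e2 (mat 1) *v (misqrt (Nm \<Sigma>) *v t)) \<bullet> (matrix_inv \<Sigma> *v kronv (aD (fst p)) (snd p))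
    - (kronv (aD (fst p)) (snd p) \<bullet> (matrix_inv \<Sigma> *v kronv (aD (fst p)) (snd p))) / 2 - (t \<bullet> t) / 2
    = fst p * ((misqrt (Pm \<Sigma>) *v s') \<bullet> snd p)
    + (kronc e2 (mat 1) *v (misqrt (Nm \<Sigma>) *v t)) \<bullet> (matrix_inv \<Sigma> *v kronv (aD (fst p)) (snd p))
    - (kronv (aD (fst p)) (snd p) \<bullet> (matrix_inv \<Sigma> *v kronv (aD (fst p)) (snd p))) / 2 - (t \<bullet> t) / 2)"
    (is "\<not> ?AE")
  proof
    assume ?AE
    then have "AE p in wgt S. fst p * (u \<bullet> snd p) = 0"
      by eventually_elim (simp add: u_def inner_diff_left algebra_simps)
    then have "AE p in lborel. 0 < ennreal (indicator S p * \<bar>fst p\<bar> ^ (CARD('k) - 2)) \<longrightarrow> fst p * (u \<bullet> snd p) = 0"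
      unfolding wgt_def by (subst (asm) AE_density) auto
    then have "AE p in lborel. p \<notin> U"
      by eventually_elim (use box in \<open>auto simp: U_def wbox_def subset_iff\<close>)
    then have "U \<in> null_sets lborel" using \<open>open U\<close> by (subst AE_iff_null_sets) auto
    then show False using \<open>\<not> negligible U\<close> by (auto simp: negligible_iff_null_sets null_sets_completionI)
  qed
qed (simp add: matrix_vector_right_distrib matrix_vector_mult_scaleR inner_add_left algebra_simps
    add_divide_distrib diff_divide_distrib)

lemma wbox_mono: "m \<le> n \<Longrightarrow> wbox m \<subseteq> wbox n" by (auto simp: wbox_def)

text \<open>The integrands are truncations of the positive, integrable \<open>lik\<close>, which
  serves as its own dominating function.\<close>

lemma
  fixes s t :: "real^'k"
  assumes \<Sigma>: "pd \<Sigma>" and k: "CARD('k) \<ge> 2"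
  shows incseq_ilik_wbox: "incseq (\<lambda>n. ilik (wbox n) \<Sigma> s t)"
    and ilik_wbox_le: "ilik (wbox n) \<Sigma> s t \<le> ilik UNIV \<Sigma> s t"
    and ilik_wbox_tendsto: "(\<lambda>n. ilik (wbox n) \<Sigma> s t) \<longlonglongrightarrow> ilik UNIV \<Sigma> s t"
proof -
  let ?L = "lik (r_of s t \<Sigma>) \<Sigma>"
  have eq: "ilik (wbox n) \<Sigma> s t = (\<integral>p. indicator (wbox n) p * ?L p \<partial>wgt UNIV)" for n
    unfolding ilik_def by (rule integral_wgt) measurable
  note int = integrable_lik[OF \<Sigma> k, of "r_of s t \<Sigma>"]
  have int_n: "integrable (wgt UNIV) (\<lambda>p. indicator (wbox n) p * ?L p)" for n
    using int by (rule Bochner_Integration.integrable_bound) (auto simp: indicator_def)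
  show "incseq (\<lambda>n. ilik (wbox n) \<Sigma> s t)"
  proof (rule incseq_SucI)
    fix n show "ilik (wbox n) \<Sigma> s t \<le> ilik (wbox (Suc n)) \<Sigma> s t"
      unfolding eq by (intro integral_mono int_n)
        (use wbox_mono[of n "Suc n"] lik_pos[of "r_of s t \<Sigma>" \<Sigma>] in \<open>auto simp: indicator_def less_imp_le\<close>)
  qed
  show "ilik (wbox n) \<Sigma> s t \<le> ilik UNIV \<Sigma> s t"
    unfolding eq unfolding ilik_def
    by (intro integral_mono int_n int) (use lik_pos[of "r_of s t \<Sigma>" \<Sigma>] in \<open>auto simp: indicator_def less_imp_le\<close>)
  show "(\<lambda>n. ilik (wbox n) \<Sigma> s t) \<longlonglongrightarrow> ilik UNIV \<Sigma> s t"
    unfolding eq unfolding ilik_def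
  proof (rule integral_dominated_convergence[where w = ?L])
    show "AE p in wgt UNIV. (\<lambda>n. indicator (wbox n) p * ?L p) \<longlonglongrightarrow> ?L p"
    proof (rule AE_I2)
      fix p :: "real \<times> (real^'k)"
      obtain N where N: "real N \<ge> max \<bar>fst p\<bar> (norm (snd p))" using real_arch_simple by blast
      have "\<forall>\<^sub>F n in sequentially. indicator (wbox n) p * ?L p = ?L p"
        using eventually_ge_at_top[of N] by eventually_elim (use N in \<open>auto simp: wbox_def indicator_def\<close>)
      then show "(\<lambda>n. indicator (wbox n) p * ?L p) \<longlonglongrightarrow> ?L p" by (rule tendsto_eventually)
    qed
  qed (use int lik_pos[of "r_of s t \<Sigma>" \<Sigma>] in \<open>auto simp: indicator_def less_imp_le\<close>)
qed

lemma IL_eq_ilik: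
  fixes R :: "real^2^'k"
  assumes "pd \<Sigma>" "CARD('k) \<ge> 2"
  shows "IL R \<Sigma> = (2 * pi) powr (- real CARD('k) / 2) * ilik UNIV \<Sigma> (Sst R \<Sigma>) (Tst R \<Sigma>)"
  by (simp add: IL_eq_integral_lik assms ilik_def r_of_Sst_Tst)

lemma IL_st_eq_ilik:
  fixes s t :: "real^'k"
  assumes "pd \<Sigma>" "CARD('k) \<ge> 2"
  shows "IL_st s t \<Sigma> = (2 * pi) powr (- real CARD('k) / 2) * ilik UNIV \<Sigma> s t"
  by (simp add: IL_st_def IL_eq_ilik assms Sst_r_of Tst_r_of)

lemma fw_wgt_over_fS:
  assumes "pd \<Sigma>"
  shows "fw (wgt S) R \<Sigma> / fS (Sst R \<Sigma>) = lik_const \<Sigma> * ilik S \<Sigma> (Sst R \<Sigma>) (Tst R \<Sigma>)"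
  by (simp add: fw_over_fS assms ilik_def r_of_Sst_Tst)

lemma fw_wgt_r_of_over_fS:
  assumes "pd \<Sigma>"
  shows "fw (wgt S) (r_of s t \<Sigma>) \<Sigma> / fS s = lik_const \<Sigma> * ilik S \<Sigma> s t"
  using fw_wgt_over_fS[OF assms, of S "r_of s t \<Sigma>"] by (simp add: Sst_r_of Tst_r_of assms)

definition quantile_ilik :: "(real \<times> (real^'k)) set \<Rightarrow> real^(2\<times>'k)^(2\<times>'k) \<Rightarrow> real \<Rightarrow> real^'k \<Rightarrow> real" where
  "quantile_ilik S \<Sigma> p t = quantile stdnormal (\<lambda>s. ilik S \<Sigma> s t) p"

section \<open>Critical values and convergence of the tests\<close>

lemma kappa_IL_eq_quantile_ilik:
  fixes t :: "real^'k"
  assumes "pd \<Sigma>" "CARD('k) \<ge> 2" "0 < \<alpha>" "\<alpha> < 1"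
  shows "kappa_IL \<alpha> t \<Sigma> = (2 * pi) powr (- real CARD('k) / 2) * quantile_ilik UNIV \<Sigma> (1 - \<alpha>) t"
proof -
  interpret prob_space "stdnormal :: (real^'k) measure" by (rule prob_space_stdnormal)
  have [measurable]: "(\<lambda>s. ilik UNIV \<Sigma> s t) \<in> borel_measurable stdnormal"
    by (intro borel_measurable_ilik assms) auto
  show ?thesis
    unfolding kappa_IL_def quantile_ilik_def using assms by (subst quantile_scale[symmetric]) (simp_all add: IL_st_eq_ilik)
qed

text \<open>By the Galois connection, a sublevel set of the quantile consists of the t at which a
  section has probability at least p, and section probabilities depend measurably on t.\<close>

lemma borel_measurable_quantile_ilik:
  fixes \<Sigma> :: "real^(2\<times>'k::finite)^(2\<times>'k)"
  assumes \<Sigma>: "pd \<Sigma>" and p: "0 < p" "p < 1"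
  shows "quantile_ilik UNIV \<Sigma> p \<in> borel_measurable borel"
proof -
  interpret prob_space "stdnormal :: (real^'k) measure" by (rule prob_space_stdnormal)
  have m: "(\<lambda>s. ilik UNIV \<Sigma> s t) \<in> borel_measurable stdnormal" for t
    by (intro borel_measurable_ilik \<Sigma>) auto
  show ?thesis
  proof (rule borel_measurable_iff_le[THEN iffD2], intro allI)
    fix c
    let ?A = "{x \<in> space (borel \<Otimes>\<^sub>M stdnormal). ilik UNIV \<Sigma> (snd x) (fst x) \<le> c}"
    have "(\<lambda>x. ilik UNIV \<Sigma> (snd x) (fst x)) \<in> borel_measurable (borel \<Otimes>\<^sub>M stdnormal)"
      by (intro borel_measurable_ilik \<Sigma>) auto
    then have "?A \<in> sets (borel \<Otimes>\<^sub>M stdnormal)" by measurable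
    then have "(\<lambda>t. measure stdnormal (Pair t -` ?A)) \<in> borel_measurable borel"
      unfolding measure_def using measurable_emeasure_Pair by measurable
    then have "{t \<in> space borel. p \<le> measure stdnormal (Pair t -` ?A)} \<in> sets borel" by measurable
    moreover have "Pair t -` ?A = {s. ilik UNIV \<Sigma> s t \<le> c}" for t
      by (auto simp: space_pair_measure)
    ultimately show "{t \<in> space borel. quantile_ilik UNIV \<Sigma> p t \<le> c} \<in> sets borel"
      using quantile_le_iff[OF m p] by (simp add: quantile_ilik_def)
  qed
qed

lemma AE_ilik_neq_quantile_ilik:
  fixes \<Sigma> :: "real^(2\<times>'k::finite)^(2\<times>'k)"
  assumes \<Sigma>: "pd \<Sigma>" and k: "CARD('k) \<ge> 2" and p: "0 < p" "p < 1"
  shows "AE R in lborel. ilik UNIV \<Sigma> (Sst R \<Sigma>) (Tst R \<Sigma>) \<noteq> quantile_ilik UNIV \<Sigma> p (Tst R \<Sigma>)"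
proof -
  \<comment> \<open>Pairs are ordered (t, s), so that Fubini fixes t and meets a level set in s with
    a constant right-hand side.\<close>
  let ?P = "\<lambda>x :: (real^'k) \<times> (real^'k). ilik UNIV \<Sigma> (snd x) (fst x) = quantile_ilik UNIV \<Sigma> p (fst x)"
  let ?g = "\<lambda>x. r_of (snd x) (fst x) \<Sigma>"
  note [measurable] = borel_measurable_quantile_ilik[OF \<Sigma> p]
  have [measurable]: "(\<lambda>x. ilik UNIV \<Sigma> (snd x) (fst x)) \<in> borel_measurable (lborel \<Otimes>\<^sub>M lborel)"
    by (intro borel_measurable_ilik \<Sigma>) auto
  have meas: "{x \<in> space (lborel \<Otimes>\<^sub>M lborel). \<not> ?P x} \<in> sets (lborel \<Otimes>\<^sub>M lborel)" by measurable
  have "AE x in lborel \<Otimes>\<^sub>M lborel. \<not> ?P x"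
  proof (rule lborel_pair.AE_pair_measure[OF meas], rule AE_I2)
    fix t :: "real^'k"
    show "AE s in lborel. \<not> ?P (t, s)"
      using AE_lborel_notin_negligible[OF negligible_level_set_ilik[OF \<Sigma> k, of UNIV t "quantile_ilik UNIV \<Sigma> p t"]] by simp
  qed
  then have "AE x in lborel. x \<notin> {x. ?P x}" unfolding lborel_prod mem_Collect_eq .
  moreover have "{x. ?P x} \<in> sets lborel"
  proof -
    have "{x. ?P x} = space (lborel \<Otimes>\<^sub>M lborel) - {x \<in> space (lborel \<Otimes>\<^sub>M lborel). \<not> ?P x}"
      by (auto simp: space_pair_measure)
    then have "{x. ?P x} \<in> sets (lborel \<Otimes>\<^sub>M lborel)" using sets.compl_sets[OF meas] by simp
    then show ?thesis unfolding lborel_prod .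
  qed
  ultimately have "{x. ?P x} \<in> null_sets lborel" using AE_iff_null_sets by blast
  then have neg: "negligible {x. ?P x}"
    by (auto simp: negligible_iff_null_sets intro: null_sets_completionI)
  have lin: "linear ?g"
    unfolding r_of_eq[OF \<Sigma>] rvec_def
    by (rule linearI) (simp_all add: matrix_vector_right_distrib kronv_add_right matrix_vector_mult_scaleR
      linear_add[OF linear_unvec] linear_scale[OF linear_unvec] scaleR_add_right)
  \<comment> \<open>A linear map between spaces of equal dimension 2k sends negligible sets to
    negligible sets. The image contains every exceptional R, since R is recovered from its own (T,
    S).\<close>
  have "negligible (?g ` {x. ?P x})"
    using neg by (rule negligible_differentiable_image_negligible[rotated])
      (simp_all add: linear_imp_differentiable_on[OF lin])
  from AE_lborel_notin_negligible[OF this] show ?thesis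
  proof eventually_elim
    case (elim R)
    then have "\<not> ?P (Tst R \<Sigma>, Sst R \<Sigma>)"
      using r_of_Sst_Tst[OF \<Sigma>, of R] by (metis (mono_tags, lifting) fst_conv image_eqI mem_Collect_eq snd_conv)
    then show ?case by simp
  qed
qed

definition kappa_wgt :: "real \<Rightarrow> nat \<Rightarrow> real^'k \<Rightarrow> real^(2\<times>'k)^(2\<times>'k) \<Rightarrow> real" where
  "kappa_wgt \<alpha> n t \<Sigma> = lik_const \<Sigma> * quantile_ilik (wbox n) \<Sigma> (1 - \<alpha>) t"

text \<open>Null level sets give the acceptance region probability exactly 1 - \<alpha>, so the
  strict rejection region has exactly \<alpha>; \<open>lik_const\<close> cancels.\<close>

lemma similar_cv_kappa_wgt:
  assumes k: "CARD('k::finite) \<ge> 2" and \<alpha>: "0 < \<alpha>" "\<alpha> < 1"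
  shows "similar_cv (wgt (wbox n :: (real \<times> (real^'k)) set)) (kappa_wgt \<alpha> n) \<alpha>"
  unfolding similar_cv_def
proof (intro allI impI)
  fix t :: "real^'k" and \<Sigma> :: "real^(2\<times>'k)^(2\<times>'k)" assume \<Sigma>: "pd \<Sigma>"
  interpret prob_space "stdnormal :: (real^'k) measure" by (rule prob_space_stdnormal)
  let ?X = "\<lambda>s. ilik (wbox n) \<Sigma> s t" and ?q = "quantile_ilik (wbox n) \<Sigma> (1 - \<alpha>) t"
  have X[measurable]: "?X \<in> borel_measurable stdnormal"
    by (intro borel_measurable_ilik \<Sigma>) auto
  have "{s. ?X s = ?q} \<in> sets stdnormal" using X by measurable
  then have "measure stdnormal {s \<in> space stdnormal. ?X s = quantile stdnormal ?X (1 - \<alpha>)} = 0"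
    unfolding quantile_ilik_def[symmetric] space_stdnormal
    by (auto intro!: measure_stdnormal_negligible negligible_level_set_ilik[OF \<Sigma> k _ wbox_mono[of 0 n]])
  then have "measure stdnormal {s. ?X s \<le> ?q} = 1 - \<alpha>"
    using measure_le_quantile[OF X] \<alpha> by (simp add: quantile_ilik_def)
  moreover have "{s. ?X s > ?q} = space stdnormal - {s. ?X s \<le> ?q}" by auto
  moreover have "{s. ?X s \<le> ?q} \<in> sets stdnormal" using X by measurable
  ultimately have "measure stdnormal {s. ?X s > ?q} = \<alpha>" by (simp only: prob_compl)
  then show "measure stdnormal {s. fw (wgt (wbox n)) (r_of s t \<Sigma>) \<Sigma> / fS s > kappa_wgt \<alpha> n t \<Sigma>} = \<alpha>"
    by (simp add: fw_wgt_r_of_over_fS \<Sigma> kappa_wgt_def lik_const_pos)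
qed

lemma wap_test_wgt_iff:
  assumes "pd \<Sigma>"
  shows "wap_test (wgt (wbox n)) (kappa_wgt \<alpha> n) R \<Sigma>
    \<longleftrightarrow> ilik (wbox n) \<Sigma> (Sst R \<Sigma>) (Tst R \<Sigma>) > quantile_ilik (wbox n) \<Sigma> (1 - \<alpha>) (Tst R \<Sigma>)"
  by (simp add: wap_test_def fw_wgt_over_fS assms kappa_wgt_def lik_const_pos)

lemma cil_iff:
  fixes R :: "real^2^'k"
  assumes "pd \<Sigma>" "CARD('k) \<ge> 2" "0 < \<alpha>" "\<alpha> < 1"
  shows "cil \<alpha> R \<Sigma> \<longleftrightarrow> ilik UNIV \<Sigma> (Sst R \<Sigma>) (Tst R \<Sigma>) > quantile_ilik UNIV \<Sigma> (1 - \<alpha>) (Tst R \<Sigma>)"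
  by (simp add: cil_def IL_eq_ilik kappa_IL_eq_quantile_ilik assms)

text \<open>Off the tie set there are two cases. If the limit statistic exceeds its quantile, the
  increasing statistics eventually pass it, and the approximating quantiles lie below it. If it is
  smaller, the approximating quantiles eventually exceed it, while the approximating statistics
  never do.\<close>

lemma AE_wap_test_eventually_cil:
  fixes \<Sigma> :: "real^(2\<times>'k::finite)^(2\<times>'k)"
  assumes \<Sigma>: "pd \<Sigma>" and k: "CARD('k) \<ge> 2" and \<alpha>: "0 < \<alpha>" "\<alpha> < 1"
  shows "AE R in lborel. \<forall>\<^sub>F n in sequentially. wap_test (wgt (wbox n)) (kappa_wgt \<alpha> n) R \<Sigma> = cil \<alpha> R \<Sigma>"
proof -
  interpret prob_space "stdnormal :: (real^'k) measure" by (rule prob_space_stdnormal)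
  have p: "0 < 1 - \<alpha>" "1 - \<alpha> < 1" using \<alpha> by auto
  from AE_ilik_neq_quantile_ilik[OF \<Sigma> k p] show ?thesis
  proof eventually_elim
    case (elim R)
    define s where "s = Sst R \<Sigma>"
    define t where "t = Tst R \<Sigma>"
    let ?X = "\<lambda>n s. ilik (wbox n) \<Sigma> s t" and ?Y = "\<lambda>s. ilik UNIV \<Sigma> s t"
    let ?qn = "\<lambda>n. quantile_ilik (wbox n) \<Sigma> (1 - \<alpha>) t" and ?q = "quantile_ilik UNIV \<Sigma> (1 - \<alpha>) t"
    have m: "?X n \<in> borel_measurable stdnormal" "?Y \<in> borel_measurable stdnormal" for n
      by (intro borel_measurable_ilik \<Sigma>; auto)+
    consider "?Y s > ?q" | "?Y s < ?q" using elim by (auto simp: s_def t_def neq_iff)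
    then show ?case
    proof cases
      case 1
      have "?qn n \<le> ?q" for n
        unfolding quantile_ilik_def by (intro quantile_mono m p ilik_wbox_le \<Sigma> k)
      moreover have "\<forall>\<^sub>F n in sequentially. ?q < ?X n s"
        using order_tendstoD(1)[OF ilik_wbox_tendsto[OF \<Sigma> k] 1] .
      ultimately have "\<forall>\<^sub>F n in sequentially. ?qn n < ?X n s"
        by (auto elim!: eventually_mono intro: le_less_trans)
      then show ?thesis using 1
        by (simp add: wap_test_wgt_iff[OF \<Sigma>] cil_iff[OF \<Sigma> k \<alpha>] s_def t_def)
    next
      case 2
      have "\<forall>\<^sub>F n in sequentially. ?Y s < ?qn n"
        unfolding quantile_ilik_def
        by (rule eventually_less_quantile[OF m p incseq_ilik_wbox[OF \<Sigma> k] ilik_wbox_tendsto[OF \<Sigma> k]])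
          (use 2 in \<open>simp add: quantile_ilik_def\<close>)
      then have "\<forall>\<^sub>F n in sequentially. \<not> ?qn n < ?X n s"
        using ilik_wbox_le[OF \<Sigma> k, of _ s t] by (auto elim!: eventually_mono simp: not_less intro: order_trans less_imp_le)
      then show ?thesis using 2
        by (simp add: wap_test_wgt_iff[OF \<Sigma>] cil_iff[OF \<Sigma> k \<alpha>] s_def t_def)
    qed
  qed
qed

section \<open>Invariance\<close>

text \<open>Linear substitution with |det Q| = 1, under which the density is unchanged.\<close>

lemma measure_stdnormal_orthogonal:
  fixes Q :: "real^'k^'k"
  assumes Q: "orthogonal_matrix Q" and A[measurable]: "A \<in> sets borel"
  shows "measure stdnormal ((\<lambda>s. Q *v s) -` A) = measure stdnormal A"
proof -
  have QQ: "transpose Q ** Q = mat 1" using Q by (simp add: orthogonal_matrix_def)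
  have fS: "fS (Q *v s) = fS s" for s
    using inner_matrix_vector[of "Q *v s" Q s] by (simp add: fS_def matrix_vector_mul_assoc QQ)
  have [measurable]: "(\<lambda>s. Q *v s) -` A \<in> sets borel"
    using measurable_sets[of "\<lambda>s. Q *v s" borel borel A] by simp
  have "emeasure stdnormal A = (\<integral>\<^sup>+s. ennreal (fS s) * indicator A s \<partial>lborel)"
    by (simp add: stdnormal_def emeasure_density)
  also have "\<dots> = ennreal \<bar>det Q\<bar> * (\<integral>\<^sup>+s. ennreal (fS (Q *v s)) * indicator A (Q *v s) \<partial>lborel)"
    using QQ by (intro nn_integral_lborel_linear) (auto simp: invertible_left_inverse)
  also have "\<bar>det Q\<bar> = 1" using det_orthogonal_matrix[OF Q] by auto
  also have "ennreal 1 * (\<integral>\<^sup>+s. ennreal (fS (Q *v s)) * indicator A (Q *v s) \<partial>lborel)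
      = (\<integral>\<^sup>+s. ennreal (fS s) * indicator ((\<lambda>s. Q *v s) -` A) s \<partial>lborel)"
    by (simp add: fS indicator_vimage)
  also have "\<dots> = emeasure stdnormal ((\<lambda>s. Q *v s) -` A)"
    by (simp add: stdnormal_def emeasure_density)
  finally show ?thesis by (simp add: measure_def)
qed

lemma quantile_stdnormal_orthogonal:
  fixes Q :: "real^'k^'k"
  assumes Q: "orthogonal_matrix Q" and [measurable]: "X \<in> borel_measurable borel"
  shows "quantile stdnormal (\<lambda>s. X (Q *v s)) p = quantile stdnormal X p"
proof -
  have "measure stdnormal {s. X (Q *v s) \<le> c} = measure stdnormal {s. X s \<le> c}" for c
  proof -
    have "{s \<in> space borel. X s \<le> c} \<in> sets borel" by measurable
    from measure_stdnormal_orthogonal[OF Q, of "{s. X s \<le> c}"] this show ?thesis by (simp add: vimage_def)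
  qed
  then show ?thesis by (simp add: quantile_def)
qed

lemma inner_orthogonal_matrix:
  fixes Q :: "real^'k^'k"
  assumes "orthogonal_matrix Q" shows "(Q *v x) \<bullet> (Q *v y) = x \<bullet> y"
  using inner_matrix_vector[of "Q *v x" Q y] assms
  by (simp add: matrix_vector_mul_assoc orthogonal_matrix_def)

text \<open>Inserting the identity as root times inverse root exposes the rotation relating the old
  and the new standardised vector.\<close>

lemma whitened_vec:
  assumes "pd P"
  shows "misqrt Q *v (Y *v z) = (misqrt Q ** Y ** msqrt P) *v (misqrt P *v z)"
proof -
  have "(misqrt Q ** Y ** msqrt P) *v (misqrt P *v z) = misqrt Q *v (Y *v ((msqrt P ** misqrt P) *v z))"
    by (simp only: matrix_vector_mul_assoc matrix_mul_assoc)
  then show ?thesis by (simp add: misqrt_msqrt assms)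
qed

section \<open>Effect of one fixed group element on the statistics and on the integrated
  likelihood\<close>

locale action =
  fixes g1 :: "real^'k::finite^'k" and g2 :: "real^2^2" and \<Sigma> :: "real^(2 \<times> 'k)^(2 \<times> 'k)"
  assumes g1: "invertible g1" and g2: "invertible g2" and lower: "g2 $ 1 $ 2 = 0" and \<Sigma>: "pd \<Sigma>"
    and k2: "CARD('k) \<ge> 2"
begin

abbreviation "a \<equiv> g2 $ 1 $ 1"
abbreviation "b \<equiv> g2 $ 2 $ 1"
abbreviation "d \<equiv> g2 $ 2 $ 2"

definition "K = kron g2 g1"
definition "\<Sigma>' = K ** \<Sigma> ** transpose K"
definition "Ract R = g1 ** R ** transpose g2"

lemma ad: "a \<noteq> 0" "d \<noteq> 0"
  using g2 lower by (auto simp: invertible_det_nz det_2)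

lemma invertible_K: "invertible K" by (simp add: K_def invertible_kron g1 g2)

lemma act_eq: "act g1 g2 R \<Sigma> = (Ract R, \<Sigma>')"
  by (simp add: act_def Ract_def \<Sigma>'_def K_def transpose_kron)

lemma vecm_Ract: "vecm (Ract R) = K *v vecm R"
  by (simp add: Ract_def K_def vecm_sandwich)

lemma pd_\<Sigma>': "pd \<Sigma>'"
proof -
  have "invertible (transpose K)" using invertible_K by (rule transpose_invertible)
  then show ?thesis
    using pd_congruence[OF \<Sigma>, of "transpose K"] by (simp add: \<Sigma>'_def invertible_iff_ker)
qed

lemma inv_\<Sigma>': "matrix_inv \<Sigma>' = transpose (matrix_inv K) ** matrix_inv \<Sigma> ** matrix_inv K"
  using invertible_K pd_invertible[OF \<Sigma>]
  by (simp add: \<Sigma>'_def matrix_inv_product matrix_inv_transpose invertible_mult transpose_invertible matrix_mul_assoc)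

lemma inv_\<Sigma>'_mult: "matrix_inv \<Sigma>' *v (K *v x) = transpose (matrix_inv K) *v (matrix_inv \<Sigma> *v x)"
  by (simp add: inv_\<Sigma>' matrix_inv_mult_vec[OF invertible_K] flip: matrix_vector_mul_assoc)

lemma form_\<Sigma>': "(K *v x) \<bullet> (matrix_inv \<Sigma>' *v (K *v y)) = x \<bullet> (matrix_inv \<Sigma> *v y)"
  using inner_matrix_vector[of "K *v x" "transpose (matrix_inv K)" "matrix_inv \<Sigma> *v y"]
  by (simp add: inv_\<Sigma>'_mult matrix_inv_mult_vec[OF invertible_K])

lemma g2_aD: "g2 *v aD x = (a * x) *\<^sub>R e1 + (b * x + d) *\<^sub>R e2"
  by (simp add: vec_eq_iff forall_2 matrix_vector_mult_def sum_2 aD_def e1_def e2_def vector_2 lower)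

lemma g2_e2: "g2 *v e2 = d *\<^sub>R e2"
  using g2_aD[of 0] by (simp add: aD_0)

lemma transpose_g2_e1: "transpose g2 *v e1 = a *\<^sub>R e1"
  by (simp add: vec_eq_iff forall_2 matrix_vector_mult_def sum_2 transpose_def e1_def vector_2 lower)

text \<open>As g2 is lower triangular, the first column of g1 R g2' is \<open>a\<close> times g1
  applied to the first column of R; \<open>YS\<close> is this map.\<close>

definition "YS = a *\<^sub>R g1"
text \<open>The dual map for T: the second block of \<Sigma>^(-1) vec(R) transforms by the inverse
  transpose of g1, with factor 1/d because g2 e2 = d e2.\<close>

definition "YT = (1 / d) *\<^sub>R transpose (matrix_inv g1)"

lemma invertible_YS: "invertible YS" and invertible_YT: "invertible YT"
  using ad g1 by (simp_all add: YS_def YT_def scalar_invertible transpose_invertible invertible_matrix_inv)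

text \<open>Tested against an arbitrary x, with \<open>K\<close> moved across the inner product onto
  the first block.\<close>

lemma block1_K:
  "transpose (kronc e1 (mat 1)) *v (K *v z) = YS *v (transpose (kronc e1 (mat 1)) *v z)"
proof -
  have "x \<bullet> (transpose (kronc e1 (mat 1)) *v (K *v z)) = x \<bullet> (YS *v (transpose (kronc e1 (mat 1)) *v z))" for x
  proof -
    have "x \<bullet> (transpose (kronc e1 (mat 1)) *v (K *v z)) = (transpose K *v kronv e1 x) \<bullet> z"
      by (simp only: inner_transpose_kronc inner_matrix_vector[of "kronv e1 x"])
    also have "transpose K *v kronv e1 x = kronv e1 (transpose YS *v x)"
      by (simp add: K_def transpose_kron kron_mult_kronv transpose_g2_e1 YS_def transpose_scalar
          flip: scaleR_matrix_vector_assoc)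
    finally show ?thesis by (simp only: inner_matrix_vector[of x YS] inner_transpose_kronc)
  qed
  then show ?thesis by (meson vector_eq_ldot)
qed

lemma inv_K_kronv_e2: "matrix_inv K *v kronv e2 x = kronv e2 (transpose YT *v x)"
proof -
  have "K *v kronv e2 (transpose YT *v x) = kronv e2 x"
    using ad by (simp add: K_def kron_mult_kronv g2_e2 YT_def transpose_scalar matrix_vector_mult_scaleR
        matrix_inv_mult_vec[OF g1] flip: scaleR_matrix_vector_assoc)
  then show ?thesis by (metis matrix_inv_mult_vec(2)[OF invertible_K])
qed

lemma block2_inv_K:
  "transpose (kronc e2 (mat 1)) *v (transpose (matrix_inv K) *v z) = YT *v (transpose (kronc e2 (mat 1)) *v z)"
proof -
  have "x \<bullet> (transpose (kronc e2 (mat 1)) *v (transpose (matrix_inv K) *v z))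
      = x \<bullet> (YT *v (transpose (kronc e2 (mat 1)) *v z))" for x
    by (simp only: inner_transpose_kronc inner_matrix_vector[of "kronv e2 x"] inner_matrix_vector[of x YT]
        transpose_transpose inv_K_kronv_e2)
  then show ?thesis by (meson vector_eq_ldot)
qed

lemma Pm_\<Sigma>': "Pm \<Sigma>' = YS ** Pm \<Sigma> ** transpose YS"
proof -
  have "Pm \<Sigma>' *v y = (YS ** Pm \<Sigma> ** transpose YS) *v y" for y
  proof -
    have "transpose K *v kronv e1 y = kronv e1 (transpose YS *v y)"
      by (simp add: K_def transpose_kron kron_mult_kronv transpose_g2_e1 YS_def transpose_scalar
          flip: scaleR_matrix_vector_assoc)
    then show ?thesis
      by (simp add: Pm_mult \<Sigma>'_def block1_K flip: matrix_vector_mul_assoc)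
  qed
  then show ?thesis by (simp add: matrix_eq)
qed

lemma Nm_\<Sigma>': "Nm \<Sigma>' = YT ** Nm \<Sigma> ** transpose YT"
proof -
  have "Nm \<Sigma>' *v y = (YT ** Nm \<Sigma> ** transpose YT) *v y" for y
    by (simp add: Nm_mult inv_\<Sigma>' block2_inv_K inv_K_kronv_e2 flip: matrix_vector_mul_assoc)
  then show ?thesis by (simp add: matrix_eq)
qed

text \<open>Symmetric roots of \<open>Pm\<close> before and after the action differ by more than
  \<open>YS\<close>; \<open>QS\<close> is the orthogonal discrepancy, and \<open>QT\<close> its
  counterpart for T.\<close>

definition "QS = misqrt (Pm \<Sigma>') ** YS ** msqrt (Pm \<Sigma>)"
definition "QT = misqrt (Nm \<Sigma>') ** YT ** msqrt (Nm \<Sigma>)"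

lemma orthogonal_QS: "orthogonal_matrix QS" and orthogonal_QT: "orthogonal_matrix QT"
  unfolding QS_def QT_def
  by (intro orthogonal_matrix_whitened pd_Pm pd_Nm \<Sigma> pd_\<Sigma>' invertible_YS invertible_YT Pm_\<Sigma>' Nm_\<Sigma>')+

lemma Sst_act: "Sst (Ract R) \<Sigma>' = QS *v Sst R \<Sigma>"
  by (simp add: Sst_eq vecm_Ract block1_K whitened_vec[OF pd_Pm[OF \<Sigma>]] QS_def)

lemma Tst_act: "Tst (Ract R) \<Sigma>' = QT *v Tst R \<Sigma>"
  by (simp add: Tst_eq vecm_Ract inv_\<Sigma>'_mult block2_inv_K whitened_vec[OF pd_Nm[OF \<Sigma>]] QT_def)

lemma r_of_act: "r_of (QS *v s) (QT *v t) \<Sigma>' = Ract (r_of s t \<Sigma>)"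
  using r_of_Sst_Tst[OF pd_\<Sigma>', of "Ract (r_of s t \<Sigma>)"]
  by (simp add: Sst_act Tst_act Sst_r_of Tst_r_of \<Sigma>)

text \<open>The action of \<open>g2\<close> on the direction \<open>(\<Delta>, 1)\<close>, read projectively.\<close>
definition "moeb x = a * x / (b * x + d)"

text \<open>The set of mean vectors is preserved: (\<Delta>, \<mu>) goes to (moeb \<Delta>, (b
  \<Delta> + d) g1 \<mu>), the scalar from normalising the second entry of the direction to 1 being
  passed to \<mu>.\<close>

lemma kronv_moeb:
  assumes "b * x + d \<noteq> 0"
  shows "kronv (aD (moeb x)) (((b * x + d) *\<^sub>R g1) *v m) = K *v kronv (aD x) m"
proof -
  have "g2 *v aD x = (b * x + d) *\<^sub>R aD (moeb x)"
    unfolding g2_aD using assms by (simp add: aD_split moeb_def scaleR_add_right)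
  then show ?thesis by (simp add: K_def kron_mult_kronv flip: scaleR_matrix_vector_assoc)
qed

lemma lik_act:
  assumes "b * x + d \<noteq> 0"
  shows "lik (Ract R) \<Sigma>' (moeb x, ((b * x + d) *\<^sub>R g1) *v m) = lik R \<Sigma> (x, m)"
  by (simp add: lik_def Let_def kronv_moeb[OF assms] vecm_Ract form_\<Sigma>' Tst_act
      inner_orthogonal_matrix[OF orthogonal_QT])

text \<open>Substituting (b x + d) g1 m for the mean parameter has Jacobian |b x + d|^k |det g1| and
  turns the transformed likelihood into the original one.\<close>

lemma IL_marginal_act:
  assumes "b * x + d \<noteq> 0"
  shows "IL_marginal (Ract R) \<Sigma>' (moeb x) = \<bar>b * x + d\<bar> ^ CARD('k) * \<bar>det g1\<bar> * IL_marginal R \<Sigma> x"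
proof -
  let ?M = "(b * x + d) *\<^sub>R g1" and ?g = "(2 * pi) powr (real CARD('k) / 2)"
  have inv: "invertible ?M" using assms g1 by (simp add: scalar_invertible)
  have dM: "\<bar>det ?M\<bar> = \<bar>b * x + d\<bar> ^ CARD('k) * \<bar>det g1\<bar>"
  proof -
    have "?M = (b * x + d) *\<^sub>R mat 1 ** g1" by (simp add: scalar_matrix_assoc[symmetric])
    then have "det ?M = (b * x + d) ^ CARD('k) * det g1"
      by (simp add: det_mul det_diagonal mat_def)
    then show ?thesis by (simp add: abs_mult power_abs)
  qed
  have l: "(\<lambda>p. lik (Ract R) \<Sigma>' (moeb x, p)) \<in> borel_measurable borel"
    by (rule measurable_compose[OF _ borel_measurable_lik]) (simp add: borel_prod[symmetric])
  have "ennreal (?g * IL_marginal (Ract R) \<Sigma>' (moeb x)) = (\<integral>\<^sup>+m. ennreal (lik (Ract R) \<Sigma>' (moeb x, m)) \<partial>lborel)"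
    by (simp add: nn_integral_lik_eq_IL_marginal pd_\<Sigma>')
  also have "\<dots> = ennreal \<bar>det ?M\<bar> * (\<integral>\<^sup>+m. ennreal (lik (Ract R) \<Sigma>' (moeb x, ?M *v m)) \<partial>lborel)"
    by (rule nn_integral_lborel_linear[OF inv]) (use l in measurable)
  also have "\<dots> = ennreal \<bar>det ?M\<bar> * ennreal (?g * IL_marginal R \<Sigma> x)"
    by (simp add: lik_act assms nn_integral_lik_eq_IL_marginal \<Sigma>)
  also have "\<dots> = ennreal (\<bar>det ?M\<bar> * (?g * IL_marginal R \<Sigma> x))"
    by (simp add: ennreal_mult IL_marginal_nonneg)
  finally have "?g * IL_marginal (Ract R) \<Sigma>' (moeb x) = \<bar>det ?M\<bar> * (?g * IL_marginal R \<Sigma> x)"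
    by (subst (asm) ennreal_inj) (simp_all add: IL_marginal_nonneg)
  then show ?thesis by (simp add: dM)
qed

text \<open>What remains of |a d| / (b x + d)^2, |b x + d|^k |det g1| and |moeb x|^(k-2) after
  removing |x|^(k-2): the powers of |b x + d| add to -2 + k - (k-2) = 0.\<close>

definition "Cact = \<bar>a\<bar> ^ (CARD('k) - 1) * \<bar>d\<bar> * \<bar>det g1\<bar>"

lemma Cact_pos: "Cact > 0"
  using ad g1 by (simp add: Cact_def invertible_det_nz)

text \<open>Change of variables along \<open>moeb\<close>, a bijection of the line with its pole
  removed onto the line with its omitted value removed.\<close>

lemma IL_act: "IL (Ract R) \<Sigma>' = Cact * IL R \<Sigma>"
proof -
  let ?k = "CARD('k)"
  define S where "S = {x. b * x + d \<noteq> 0}"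
  let ?f = "\<lambda>x. IL_marginal R \<Sigma> x * \<bar>x\<bar> ^ (?k - 2)"
  let ?f' = "\<lambda>x. IL_marginal (Ract R) \<Sigma>' x * \<bar>x\<bar> ^ (?k - 2)"
  note int = integrable_IL_marginal[OF \<Sigma> k2, of R] and int' = integrable_IL_marginal[OF pd_\<Sigma>' k2, of "Ract R"]
  have "open S" unfolding S_def by (intro open_Collect_neq continuous_intros)
  have negS: "negligible (- S)"
  proof (rule negligible_subset)
    have "x = - d / b" if "b * x + d = 0" for x
    proof -
      have "b \<noteq> 0" "b * x = - d" using that ad by auto
      then show ?thesis by (metis nonzero_mult_div_cancel_left)
    qed
    \<comment> \<open>When b = 0 there is no pole and the complement is empty, so the value of - d /
      0 is harmless.\<close>
    then show "- S \<subseteq> {- d / b}" by (auto simp: S_def)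
  qed simp
  have negmS: "negligible (- (moeb ` S))"
  proof (rule negligible_subset)
    show "- (moeb ` S) \<subseteq> {a / b}"
    proof
      fix y assume y: "y \<in> - (moeb ` S)"
      show "y \<in> {a / b}"
      proof (rule ccontr)
        assume "y \<notin> {a / b}"
        then have h: "a - b * y \<noteq> 0" using ad by (cases "b = 0") (auto simp: field_simps)
        \<comment> \<open>The preimage of y is d y / (a - b y); its denominator under
          \<open>moeb\<close> is a d / (a - b y), which is nonzero.\<close>
        have "b * (d * y / (a - b * y)) + d = a * d / (a - b * y)" using h by (simp add: field_simps)
        then have "d * y / (a - b * y) \<in> S" "moeb (d * y / (a - b * y)) = y"
          using h ad by (simp_all add: S_def moeb_def)
        then show False using y by (metis ComplD image_eqI)
      qed
    qed
  qed simp
  have inj: "inj_on moeb S"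
  proof (rule inj_onI)
    fix x y assume "x \<in> S" "y \<in> S" "moeb x = moeb y"
    then have "a * (x * (b * y + d)) = a * (y * (b * x + d))" by (simp add: S_def moeb_def field_simps)
    then show "x = y" using ad by (simp add: algebra_simps)
  qed
  have der: "(moeb has_field_derivative a * d / (b * x + d)\<^sup>2) (at x within S)" if "x \<in> S" for x
    unfolding moeb_def[abs_def] using that
    by (auto simp: S_def power2_eq_square field_simps intro!: derivative_eq_intros)
  \<comment> \<open>The pointwise cancellation for which the exponent k - 2 is chosen: no power of b
    x + d survives.\<close>
  have eq: "\<bar>a * d / (b * x + d)\<^sup>2\<bar> * ?f' (moeb x) = Cact * ?f x" if "x \<in> S" for x
  proof -
    let ?h = "\<bar>b * x + d\<bar>"
    have h: "b * x + d \<noteq> 0" using that by (simp add: S_def)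
    have "?k = 2 + (?k - 2)" "?k - 1 = Suc (?k - 2)" using k2 by auto
    then have "?h ^ ?k = ?h\<^sup>2 * ?h ^ (?k - 2)" "\<bar>a\<bar> ^ (?k - 1) = \<bar>a\<bar> * \<bar>a\<bar> ^ (?k - 2)"
      by (metis power_add, metis power_Suc)
    moreover have "\<bar>moeb x\<bar> = \<bar>a\<bar> * \<bar>x\<bar> / ?h" by (simp add: moeb_def abs_mult)
    ultimately show ?thesis
      unfolding IL_marginal_act[OF h] using h
      by (simp add: Cact_def abs_mult power_mult_distrib power_divide)
  qed
  have "?f' absolutely_integrable_on (moeb ` S)"
  proof -
    have "?f' absolutely_integrable_on UNIV"
      using integrable_completion[of ?f' lborel] int' by (simp add: set_integrable_def borel_measurable_integrable)
    then show ?thesis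
      using negmS by (elim absolutely_integrable_spike_set) (auto intro: negligible_subset)
  qed
  then have cov: "integral S (\<lambda>x. \<bar>a * d / (b * x + d)\<^sup>2\<bar> * ?f' (moeb x)) = integral (moeb ` S) ?f'"
    using has_absolute_integral_change_of_variables_1'[OF _ der inj, of ?f' "integral (moeb ` S) ?f'"] \<open>open S\<close>
    by simp
  \<comment> \<open>The substitution rule concerns gauge integrals over sets; this returns to the
    Lebesgue integral over the whole line.\<close>
  have spike: "integral T h = (\<integral>x. h x \<partial>lborel)" if "negligible (- T)" "integrable lborel h" for T and h :: "real \<Rightarrow> real"
  proof -
    have "integral T h = integral UNIV h"
      by (rule integral_spike_set) (use that(1) in \<open>auto intro: negligible_subset\<close>)
    then show ?thesis using integral_lborel[OF that(2)] by simp
  qed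
  have "IL (Ract R) \<Sigma>' = integral (moeb ` S) ?f'"
    by (simp add: IL_eq_IL_marginal spike[OF negmS int'])
  also have "\<dots> = integral S (\<lambda>x. Cact * ?f x)"
    unfolding cov[symmetric] by (rule integral_cong) (rule eq)
  also have "\<dots> = (\<integral>x. Cact * ?f x \<partial>lborel)"
    by (rule spike[OF negS]) (use int in simp)
  finally show ?thesis by (simp add: IL_eq_IL_marginal)
qed

text \<open>Replacing s by its rotation leaves N(0, I) unchanged and turns the statistic into
  \<open>Cact\<close> times the original at every s, so the quantile scales too.\<close>

lemma kappa_IL_act:
  assumes \<alpha>: "0 < \<alpha>" "\<alpha> < 1"
  shows "kappa_IL \<alpha> (QT *v t) \<Sigma>' = Cact * kappa_IL \<alpha> t \<Sigma>"
proof -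
  interpret prob_space "stdnormal :: (real^'k) measure" by (rule prob_space_stdnormal)
  have m: "(\<lambda>s. IL_st s t' \<Theta>) \<in> borel_measurable borel" if "pd \<Theta>" for t' and \<Theta> :: "real^(2 \<times> 'k)^(2 \<times> 'k)"
    unfolding IL_st_eq_ilik[OF that k2] by (intro borel_measurable_times borel_measurable_ilik that) auto
  have "kappa_IL \<alpha> (QT *v t) \<Sigma>' = quantile stdnormal (\<lambda>s. IL_st (QS *v s) (QT *v t) \<Sigma>') (1 - \<alpha>)"
    unfolding kappa_IL_def by (rule quantile_stdnormal_orthogonal[OF orthogonal_QS m[OF pd_\<Sigma>'], symmetric])
  also have "\<dots> = quantile stdnormal (\<lambda>s. Cact * IL_st s t \<Sigma>) (1 - \<alpha>)"
    by (simp add: IL_st_def r_of_act IL_act)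
  also have "\<dots> = Cact * kappa_IL \<alpha> t \<Sigma>"
    unfolding kappa_IL_def using m[OF \<Sigma>] \<alpha> Cact_pos by (intro quantile_scale) auto
  finally show ?thesis .
qed

lemma cil_act:
  assumes "0 < \<alpha>" "\<alpha> < 1"
  shows "cil \<alpha> (Ract R) \<Sigma>' = cil \<alpha> R \<Sigma>"
  using Cact_pos by (simp add: cil_def Tst_act kappa_IL_act[OF assms] IL_act)

end

text \<open>The weights and critical value functions are chosen once for all \<Sigma>. For positive
  definite \<Sigma> the law of vec(R) has a Lebesgue density for every (\<Delta>, \<mu>), so the
  exceptional set of R is null under the null and every alternative.\<close>

theorem theorem3:
  assumes k2: "CARD('k::finite) \<ge> 2"
    and alpha: "0 < \<alpha>" "\<alpha> < 1"
  shows "(\<forall>(g1::real^'k^'k) (g2::real^2^2) (R::real^2^'k) \<Sigma>.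
            invertible g1 \<and> invertible g2 \<and> g2 $ 1 $ 2 = 0 \<and> pd \<Sigma> \<longrightarrow>
            cil \<alpha> (fst (act g1 g2 R \<Sigma>)) (snd (act g1 g2 R \<Sigma>)) = cil \<alpha> R \<Sigma>)
       \<and> (\<exists>(w :: nat \<Rightarrow> (real \<times> (real^'k)) measure) \<kappa>.
            (\<forall>n. finite_measure (w n) \<and> sets (w n) = sets borel \<and> similar_cv (w n) (\<kappa> n) \<alpha>)
          \<and> (\<forall>\<Sigma>. pd \<Sigma> \<longrightarrow>
               (AE R in lborel. \<forall>\<^sub>F n in sequentially. wap_test (w n) (\<kappa> n) R \<Sigma> = cil \<alpha> R \<Sigma>)))"
proof (intro conjI allI impI)
  fix g1 :: "real^'k^'k" and g2 :: "real^2^2" and R :: "real^2^'k" and \<Sigma> :: "real^(2\<times>'k)^(2\<times>'k)"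
  assume "invertible g1 \<and> invertible g2 \<and> g2 $ 1 $ 2 = 0 \<and> pd \<Sigma>"
  then interpret action g1 g2 \<Sigma> using k2 by unfold_locales auto
  show "cil \<alpha> (fst (act g1 g2 R \<Sigma>)) (snd (act g1 g2 R \<Sigma>)) = cil \<alpha> R \<Sigma>"
    using cil_act[OF alpha] by (simp add: act_eq)
next
  show "\<exists>(w :: nat \<Rightarrow> (real \<times> (real^'k)) measure) \<kappa>.
            (\<forall>n. finite_measure (w n) \<and> sets (w n) = sets borel \<and> similar_cv (w n) (\<kappa> n) \<alpha>)
          \<and> (\<forall>\<Sigma>. pd \<Sigma> \<longrightarrow>
               (AE R in lborel. \<forall>\<^sub>F n in sequentially. wap_test (w n) (\<kappa> n) R \<Sigma> = cil \<alpha> R \<Sigma>))"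
    using similar_cv_kappa_wgt[OF k2 alpha] AE_wap_test_eventually_cil[OF _ k2 alpha] finite_measure_wgt_wbox
    by (intro exI[of _ "\<lambda>n. wgt (wbox n)"] exI[of _ "kappa_wgt \<alpha>"]) auto
qed

end
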